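(* Fix the number of modes $N\in\mathbb{N}$, the upsampled grid size $n>N$ (hence the upsampling factor $\sigma=n/N>1$), and the safety factor $\gamma\in(0,1)$. For each kernel width $w\in\mathbb{N}$ set $\beta=\gamma\pi w\left(1-\frac{1}{2\sigma}\right)$, and use the kernel $\phi(z)=e^{\beta(\sqrt{1-z^2}-1)}$ for $|z|\le 1$, $\phi(z)=0$ otherwise, in the one-dimensional type 1 and type 2 NUFFT algorithms described in the context, carried out in exact arithmetic. Let $$\varepsilon_\infty=\varepsilon_\infty(w):=\frac{\max_{|k|\le N/2,\;x\in\mathbb{R}}\Bigl|\sum_{m\in\mathbb{Z},\,m\ne0}\hat\psi(k+mn)\,e^{i(k+mn)x}\Bigr|}{\min_{|k|\le N/2}|\hat\psi(k)|},$$ where $\psi(x)=\phi(nx/(\pi w))$. Then the constant $\varepsilon_\infty$, which bounds the errors as $$\max_{-N/2\le k<N/2}|\tilde f_k-f_k|\le\varepsilon_\infty\sum_{j=1}^M|c_j|\quad\text{(type 1)},\qquad \max_{1\le j\le M}|\tilde c_j-c_j|\le\varepsilon_\infty\sum_{-N/2\le k<N/2}|f_k|\quad\text{(type 2)},$$ converges with respect to the kernel width $w$ as $$\varepsilon_\infty=\mathcal{O}\left(\sqrt{w}\;e^{-\pi w\gamma\sqrt{1-1/\sigma-(\gamma^{-2}-1)/(4\sigma^2)}}\right),\qquad w\to\infty.$$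
   Context: Fourier transform convention: $\hat g(\xi)=\int_{-\infty}^{\infty}g(x)e^{i\xi x}\,dx$. Indices $k$ are integers. The conditionally convergent sum over $m\neq0$ is the limit of symmetric partial sums over $0<|m|\le m_0$ as $m_0\to\infty$. Type 1 task: given points $x_j\in[-\pi,\pi)$ and strengths $c_j\in\mathbb{C}$, $j=1,\dots,M$, compute $f_k=\sum_{j=1}^M c_je^{ikx_j}$ for $-N/2\le k<N/2$. Type 2 task (adjoint): given coefficients $f_k\in\mathbb{C}$, $-N/2\le k<N/2$, compute $c_j=\sum_{-N/2\le k<N/2}f_ke^{-ikx_j}$, $j=1,\dots,M$. Algorithm. The upsampled grid has the $n$ nodes $2\pi l/n$, $l=0,\dots,n-1$. Let $\psi(x)=\phi(nx/(\pi w))$, which has support $[-\pi w/n,\pi w/n]$, and let $\tilde\psi(x)=\sum_{m\in\mathbb{Z}}\psi(x-2\pi m)$ be its periodization. Let $$p_k=\frac{2\pi}{n\hat\psi(k)}=\frac{2}{w\,\hat\phi(\pi wk/n)},\qquad -N/2\le k<N/2 .$$ Type 1 approximation: $b_l=\sum_{j=1}^M c_j\tilde\psi(2\pi l/n-x_j)$ for $l=0,\dots,n-1$, then $\tilde f_k=p_k\sum_{l=0}^{n-1}e^{2\pi ilk/n}b_l$ for $-N/2\le k<N/2$. Type 2 approximation: the adjoint of this linear map $\mathbf{c}\mapsto\tilde{\mathbf{f}}$ applied to $\mathbf{f}$, i.e. $\tilde c_j=\sum_{l=0}^{n-1}\tilde\psi(2\pi l/n-x_j)\sum_{-N/2\le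 k<N/2}e^{-2\pi ilk/n}p_kf_k$. Convention at jumps: if $\psi$ has to be evaluated exactly at one of its two jump discontinuities $x=\pm\pi w/n$, its value there is taken to be the average of its one-sided limits (that is, $e^{-\beta}/2$).
   Formalization: The rate is stated only when 1-1/σ-(γ^{-2}-1)/(4σ²) ≥ 0, since otherwise its square root is not real; the error bounds assume ψ̂(k)≠0 for |k|≤N/2 (proved when the rate applies), and the maximum over x is read as a supremum. *)

theory Defs
  imports "HOL-Analysis.Analysis" "HOL-Library.Landau_Symbols"
begin

definition fourier :: "(real \<Rightarrow> real) \<Rightarrow> real \<Rightarrow> complex" where
  "fourier g \<xi> = (LINT x|lborel. complex_of_real (g x) * cis (\<xi> * x))"

definition es_kernel :: "real \<Rightarrow> real \<Rightarrow> real" where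
  "es_kernel \<beta> z = (if \<bar>z\<bar> \<le> 1 then exp (\<beta> * (sqrt (1 - z\<^sup>2) - 1)) else 0)"

text \<open>The rescaled kernel. At its two jump discontinuities it takes the average of the
  one-sided limits, which are \<open>exp (- \<beta>)\<close> and \<open>0\<close>.\<close>

definition psi :: "nat \<Rightarrow> nat \<Rightarrow> real \<Rightarrow> real \<Rightarrow> real" where
  "psi n w \<beta> x =
     (if \<bar>x\<bar> = pi * real w / real n then exp (- \<beta>) / 2
      else es_kernel \<beta> (real n * x / (pi * real w)))"

abbreviation psi_hat :: "nat \<Rightarrow> nat \<Rightarrow> real \<Rightarrow> int \<Rightarrow> complex" where
  "psi_hat n w \<beta> k \<equiv> fourier (psi n w \<beta>) (real_of_int k)"

text \<open>Only finitely many terms are nonzero.\<close>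

definition psi_periodized :: "nat \<Rightarrow> nat \<Rightarrow> real \<Rightarrow> real \<Rightarrow> real" where
  "psi_periodized n w \<beta> x = (\<Sum>\<^sub>\<infinity>m::int. psi n w \<beta> (x - 2 * pi * real_of_int m))"

definition modes :: "nat \<Rightarrow> int set" where
  "modes N = {k. - real N / 2 \<le> real_of_int k \<and> real_of_int k < real N / 2}"

definition sym_modes :: "nat \<Rightarrow> int set" where
  "sym_modes N = {k. \<bar>real_of_int k\<bar> \<le> real N / 2}"

definition type1_exact :: "nat \<Rightarrow> (nat \<Rightarrow> real) \<Rightarrow> (nat \<Rightarrow> complex) \<Rightarrow> int \<Rightarrow> complex" where
  "type1_exact M x c k = (\<Sum>j=1..M. c j * cis (real_of_int k * x j))"

definition type2_exact :: "nat \<Rightarrow> (nat \<Rightarrow> real) \<Rightarrow> (int \<Rightarrow> complex) \<Rightarrow> nat \<Rightarrow> complex" where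
  "type2_exact N x f j = (\<Sum>k\<in>modes N. f k * cis (- (real_of_int k * x j)))"

definition correction :: "nat \<Rightarrow> nat \<Rightarrow> real \<Rightarrow> int \<Rightarrow> complex" where
  "correction n w \<beta> k = 2 * complex_of_real pi / (of_nat n * psi_hat n w \<beta> k)"

definition spread ::
  "nat \<Rightarrow> nat \<Rightarrow> real \<Rightarrow> nat \<Rightarrow> (nat \<Rightarrow> real) \<Rightarrow> (nat \<Rightarrow> complex) \<Rightarrow> nat \<Rightarrow> complex" where
  "spread n w \<beta> M x c l =
     (\<Sum>j=1..M. c j * complex_of_real (psi_periodized n w \<beta> (2 * pi * real l / real n - x j)))"

definition type1_nufft ::
  "nat \<Rightarrow> nat \<Rightarrow> real \<Rightarrow> nat \<Rightarrow> (nat \<Rightarrow> real) \<Rightarrow> (nat \<Rightarrow> complex) \<Rightarrow> int \<Rightarrow> complex" where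
  "type1_nufft n w \<beta> M x c k =
     correction n w \<beta> k *
     (\<Sum>l<n. cis (2 * pi * real l * real_of_int k / real n) * spread n w \<beta> M x c l)"

definition type2_nufft ::
  "nat \<Rightarrow> nat \<Rightarrow> nat \<Rightarrow> real \<Rightarrow> (nat \<Rightarrow> real) \<Rightarrow> (int \<Rightarrow> complex) \<Rightarrow> nat \<Rightarrow> complex" where
  "type2_nufft N n w \<beta> x f j =
     (\<Sum>l<n. complex_of_real (psi_periodized n w \<beta> (2 * pi * real l / real n - x j)) *
       (\<Sum>k\<in>modes N. cis (- (2 * pi * real l * real_of_int k / real n)) *
                      correction n w \<beta> k * f k))"

definition alias_partial :: "nat \<Rightarrow> nat \<Rightarrow> real \<Rightarrow> int \<Rightarrow> real \<Rightarrow> nat \<Rightarrow> complex" where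
  "alias_partial n w \<beta> k x m0 =
     (\<Sum>m\<in>{- int m0..int m0} - {0}.
        psi_hat n w \<beta> (k + m * int n) * cis (real_of_int (k + m * int n) * x))"

text \<open>The series converges only conditionally, as a limit of symmetric partial sums.\<close>

definition alias_sum :: "nat \<Rightarrow> nat \<Rightarrow> real \<Rightarrow> int \<Rightarrow> real \<Rightarrow> complex" where
  "alias_sum n w \<beta> k x = lim (alias_partial n w \<beta> k x)"

text \<open>The maximum over real \<open>x\<close> is rendered as a supremum: \<open>alias_sum\<close> jumps in \<open>x\<close> and
  takes averaged values there, so its largest modulus need not be attained.\<close>

definition eps_inf :: "nat \<Rightarrow> nat \<Rightarrow> nat \<Rightarrow> real \<Rightarrow> real" where
  "eps_inf N n w \<beta> =
     (SUP (k, x)\<in>sym_modes N \<times> UNIV. cmod (alias_sum n w \<beta> k x)) /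
     (MIN k\<in>sym_modes N. cmod (psi_hat n w \<beta> k))"

end

theory Submission
  imports Defs "HOL-Complex_Analysis.Complex_Analysis"
begin

text \<open>Up to the factor \<open>exp (- \<beta>)\<close> and scaling, the kernel is
  \<open>cap \<beta> z = exp (\<beta> * sqrt (1 - z\<^sup>2))\<close>. Split its transform as
  \<open>cap_cos \<beta> = cap_odd \<beta> + cap_cos (- \<beta>)\<close>. With \<open>z = sin \<theta>\<close>, the odd part is an integral over
  the full circle, which is a function of \<open>\<beta>\<^sup>2 - \<rho>\<^sup>2\<close> only, up to a factor \<open>\<beta>\<close>: it is a multiple
  of \<open>I\<^sub>1 s / s\<close> with \<open>s\<^sup>2 = \<beta>\<^sup>2 - \<rho>\<^sup>2\<close> below the cutoff \<open>\<rho> = \<beta>\<close> and of \<open>J\<^sub>1 t / t\<close> with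
  \<open>t\<^sup>2 = \<rho>\<^sup>2 - \<beta>\<^sup>2\<close> above it. The growth of the former bounds the denominator of
  \<open>eps_inf\<close> from below. All alias frequencies are above the cutoff, by a factor at least
  \<open>1 / \<gamma>\<close>, so the odd part contributes an absolutely convergent sum to the numerator. The remainder
  \<open>cap (- \<beta>)\<close> is bounded by 1, and Poisson summation turns its alias sum
  into an average of its values on a grid, which is bounded too.

  Poisson summation with averaged values at the jumps is obtained from Chernoff's argument:
  if \<open>g u / (cis u - 1)\<close> is integrable, the Fourier series of \<open>g\<close> telescopes at \<open>0\<close>, and the
  Riemann--Lebesgue lemma gives its sum.\<close>

section \<open>Fourier series at a point and Poisson summation\<close>

text \<open>The split is dictated by the edges. \<open>cap \<kappa>\<close> jumps by 1 at
  \<open>\<plusminus>1\<close> for every \<open>\<kappa>\<close>, so its transform decays only like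
  the reciprocal frequency and the alias series converges only conditionally. The jump cancels in
  \<open>cap \<beta> - cap (- \<beta>)\<close>, which vanishes like a square root at the edges; its
  transform decays with exponent \<open>-3/2\<close> and can be summed in absolute value. What is
  left carries the jump but no exponential growth. The prefactor
  \<open>pi * w / n * exp (- \<beta>)\<close> is common to numerator and denominator of
  \<open>eps_inf\<close>. Apart from it the numerator is bounded, and the rate comes from the
  denominator: \<open>\<beta> * I_1 s / s\<close> has order
  \<open>\<beta> * exp s / s powr (3/2)\<close>, and \<open>s \<le> \<beta>\<close> leaves at least
  \<open>exp s / sqrt \<beta>\<close>, whence the factor \<open>sqrt w\<close>. The smallest
  \<open>s\<close> occurs at the band edge \<open>\<bar>k\<bar> = N / 2\<close> and is the exponent
  of the rate. The root in the rate is real when the band edge does not exceed the cutoff. Equality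
  is allowed, so the lower bounds must survive \<open>s = 0\<close>: hence \<open>1 + s\<close> in
  place of \<open>s\<close>, and a limit argument at the cutoff.\<close>

abbreviation circ :: "real measure" where
  "circ \<equiv> restrict_space lborel {- pi..pi}"

lemma finite_measure_circ: "finite_measure circ"
  by (rule finite_measureI) (simp add: emeasure_restrict_space space_restrict_space)

lemma integrable_circ_bounded:
  fixes f :: "real \<Rightarrow> complex"
  assumes "f \<in> borel_measurable borel" and "\<And>u. \<bar>u\<bar> \<le> pi \<Longrightarrow> cmod (f u) \<le> B"
  shows "integrable circ f"
proof (rule finite_measure.integrable_const_bound[OF finite_measure_circ])
  show "AE u in circ. norm (f u) \<le> B"
    using assms(2) by (auto intro!: AE_I2 simp: space_restrict_space abs_le_iff)
  show "f \<in> borel_measurable circ"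
    using assms(1) by (simp add: measurable_restrict_space1)
qed

lemma measurable_cis [measurable]: "cis \<in> borel_measurable borel"
  by (intro borel_measurable_continuous_onI continuous_intros)

section \<open>Bessel's inequality and the Riemann--Lebesgue lemma\<close>

lemma integral_circ_cis:
  "(LINT u|circ. cis (of_int m * u)) = (if m = 0 then 2 * pi else 0)"
proof -
  have "(LINT u|circ. cis (of_int m * u)) = (LINT u:{-pi..pi}|lborel. cis (of_int m * u))"
    by (simp add: integral_restrict_space set_lebesgue_integral_def)
  also have "\<dots> = integral {-pi..pi} (\<lambda>u. cis (of_int m * u))"
    by (intro set_borel_integral_eq_integral borel_integrable_atLeastAtMost'
          continuous_intros)
  also have "\<dots> = (if m = 0 then 2 * pi else 0)"
  proof (cases "m = 0")
    case True then show ?thesis by (simp add: scaleR_conv_of_real)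
  next
    case False
    have [simp]: "sin (of_int m * pi) = 0" by (simp add: sin_zero_iff_int2)
    have "((\<lambda>u. cis (of_int m * u)) has_integral
        (cis (of_int m * pi) / (\<i> * of_int m) - cis (of_int m * (-pi)) / (\<i> * of_int m))) {-pi..pi}"
      using False
      by (intro fundamental_theorem_of_calculus)
         (auto simp: has_vector_derivative_def scaleR_conv_of_real fun_eq_iff complex_eq_iff
           intro!: derivative_eq_intros)
    moreover have "cis (of_int m * pi) = cis (of_int m * (-pi))"
      by (simp add: complex_eq_iff)
    ultimately show ?thesis using False by (simp add: integral_unique)
  qed
  finally show ?thesis .
qed

text \<open>Removing from \<open>h\<close> its projection onto one more character lowers the energy
  by exactly \<open>(cmod (c m))\<^sup>2 / (2 * pi)\<close>, and energy stays nonnegative.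
  Nonnegative frequencies suffice, since the others are reached by conjugation.\<close>

lemma bessel_circ:
  fixes h :: "real \<Rightarrow> complex" and M :: nat
  assumes [measurable]: "h \<in> borel_measurable borel" and bd: "\<And>u. cmod (h u) \<le> B"
  defines "c \<equiv> (\<lambda>m::nat. LINT u|circ. h u * cis (of_int (int m) * u))"
  shows "(\<Sum>m<M. (cmod (c m))\<^sup>2) \<le> 2 * pi * (LINT u|circ. (cmod (h u))\<^sup>2)"
proof -
  define r where "r M u = h u - (\<Sum>m<M. c m * cis (- (of_int (int m) * u)) / (2 * pi))" for M u
  have [measurable]: "r M \<in> borel_measurable borel" for M
    unfolding r_def by measurable
  have rbd: "\<exists>R. \<forall>u. cmod (r M u) \<le> R" for M
  proof (intro exI allI)
    fix u
    have "cmod (r M u) \<le> cmod (h u) + (\<Sum>m<M. cmod (c m * cis (- (of_int (int m) * u)) / (2 * pi)))"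
      unfolding r_def by (rule order_trans[OF norm_triangle_ineq4]) (intro add_left_mono norm_sum)
    also have "\<dots> \<le> B + (\<Sum>m<M. cmod (c m) / (2 * pi))"
      using bd[of u] by (intro add_mono) (auto simp: norm_mult norm_divide)
    finally show "cmod (r M u) \<le> B + (\<Sum>m<M. cmod (c m) / (2 * pi))" .
  qed
  have int_h: "integrable circ (\<lambda>u. h u * cis (of_int (int m) * u))" for m
    by (rule integrable_circ_bounded[where B=B]) (auto simp: norm_mult bd)
  have int_cis: "integrable circ (\<lambda>u. z * cis (of_int k * u))" for k z
    by (rule integrable_circ_bounded[where B="cmod z"]) (auto simp: norm_mult)
  \<comment> \<open>By orthogonality, subtracting the modes below \<open>M\<close> leaves the
    coefficient at \<open>M\<close> unchanged.\<close>
  have coeff: "(LINT u|circ. r M u * cis (of_int (int M) * u)) = c M" for M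
  proof -
    have "(LINT u|circ. r M u * cis (of_int (int M) * u)) =
        (LINT u|circ. h u * cis (of_int (int M) * u) -
           (\<Sum>m<M. (c m / (2 * pi)) * cis (of_int (int M - int m) * u)))"
      unfolding r_def
    proof (intro Bochner_Integration.integral_cong refl)
      fix u
      have "c m * cis (- (of_int (int m) * u)) / (2 * pi) * cis (of_int (int M) * u) =
          (c m / (2 * pi)) * cis (of_int (int M - int m) * u)" for m
      proof -
        have "cis (of_int (int M - int m) * u) = cis (- (of_int (int m) * u)) * cis (of_int (int M) * u)"
          by (simp add: cis_mult algebra_simps)
        then show ?thesis by simp
      qed
      then show "(h u - (\<Sum>m<M. c m * cis (- (of_int (int m) * u)) / (2 * pi))) * cis (of_int (int M) * u) =
          h u * cis (of_int (int M) * u) - (\<Sum>m<M. (c m / (2 * pi)) * cis (of_int (int M - int m) * u))"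
        by (simp only: left_diff_distrib sum_distrib_right)
    qed
    also have "\<dots> = c M - (\<Sum>m<M. (LINT u|circ. (c m / (2 * pi)) * cis (of_int (int M - int m) * u)))"
      unfolding c_def
      by (subst Bochner_Integration.integral_diff)
         (auto intro!: int_h int_cis Bochner_Integration.integrable_sum simp del: of_int_diff of_int_of_nat_eq
            simp: Bochner_Integration.integral_sum int_cis)
    also have "\<dots> = c M"
      by (simp add: integral_circ_cis del: of_int_diff)
    finally show ?thesis .
  qed
  have int_sq: "integrable circ (\<lambda>u. (cmod (r M u))\<^sup>2)" for M
  proof -
    obtain R where R: "\<And>u. cmod (r M u) \<le> R" using rbd by blast
    have "integrable circ (\<lambda>u. complex_of_real ((cmod (r M u))\<^sup>2))"
      by (rule integrable_circ_bounded[where B="R\<^sup>2"])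
         (auto simp: norm_power intro!: power_mono R)
    then show ?thesis by (simp only: complex_of_real_integrable_eq)
  qed
  have int_rc: "integrable circ (\<lambda>u. z * (r M u * cis (of_int k * u)))" for M k z
  proof -
    obtain R where R: "\<And>u. cmod (r M u) \<le> R" using rbd by blast
    show ?thesis
      by (rule integrable_circ_bounded[where B="cmod z * R"])
         (auto simp: norm_mult intro!: mult_left_mono R)
  qed
  have meas: "measure circ (space circ) = 2 * pi"
    by (simp add: measure_restrict_space space_restrict_space)
  have "(LINT u|circ. (cmod (r M u))\<^sup>2) = (LINT u|circ. (cmod (h u))\<^sup>2) - (\<Sum>m<M. (cmod (c m))\<^sup>2) / (2 * pi)"
  proof (induction M)
    case 0 show ?case by (simp add: r_def)
  next
    case (Suc M)
    \<comment> \<open>After integration the cross term removes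
      \<open>(cmod (c M))\<^sup>2 / pi\<close> and the last term gives half of it back.\<close>
    have sq: "(cmod (r (Suc M) u))\<^sup>2 =
      (cmod (r M u))\<^sup>2 - Re ((cnj (c M) / pi) * (r M u * cis (of_int (int M) * u))) + (cmod (c M))\<^sup>2 / (4 * pi\<^sup>2)"
      for u
    proof -
      have e: "r (Suc M) u = r M u - c M * cnj (cis (of_int (int M) * u)) / (2 * pi)"
        by (simp add: r_def cis_cnj)
      have cc: "cis (of_int (int M) * u) * cnj (cis (of_int (int M) * u)) = 1"
        by (simp add: complex_eq_iff power2_eq_square[symmetric])
      have gen: "(cmod (a - z * cnj e / (2 * pi)))\<^sup>2 =
          (cmod a)\<^sup>2 - Re ((cnj z / pi) * (a * e)) + (cmod z)\<^sup>2 / (4 * pi\<^sup>2)"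
        if "e * cnj e = 1" for a z e :: complex
      proof -
        have "complex_of_real ((cmod e)\<^sup>2) = 1"
          using that by (simp add: complex_norm_square del: of_real_power)
        then have ee: "(cmod e)\<^sup>2 = 1" by (simp only: of_real_eq_1_iff)
        define y where "y = z * cnj e / (2 * pi)"
        have "(cmod (a - y))\<^sup>2 = (cmod a)\<^sup>2 - 2 * Re (a * cnj y) + (cmod y)\<^sup>2"
          unfolding cmod_power2 by (simp add: power2_eq_square algebra_simps)
        moreover have "a * cnj y = ((cnj z / pi) * (a * e)) / of_real 2"
          by (simp add: y_def field_simps)
        then have "2 * Re (a * cnj y) = Re ((cnj z / pi) * (a * e))"
          by (simp only: Re_divide_of_real)
        moreover have "(cmod y)\<^sup>2 = (cmod z)\<^sup>2 / (4 * pi\<^sup>2)"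
          using ee by (simp add: y_def norm_mult norm_divide power_divide power_mult_distrib)
        ultimately show ?thesis by (simp add: y_def)
      qed
      show ?thesis unfolding e by (rule gen[OF cc])
    qed
    have "(LINT u|circ. (cmod (r (Suc M) u))\<^sup>2) =
       (LINT u|circ. (cmod (r M u))\<^sup>2) -
       (LINT u|circ. Re ((cnj (c M) / pi) * (r M u * cis (of_int (int M) * u))))
        + (LINT u|circ. (cmod (c M))\<^sup>2 / (4 * pi\<^sup>2))"
      unfolding sq
      using int_sq[of M] integrable_Re[OF int_rc[of "cnj (c M) / pi" M "int M"]]
        finite_measure.integrable_const[OF finite_measure_circ, of "(cmod (c M))\<^sup>2 / (4 * pi\<^sup>2)"]
      by (subst Bochner_Integration.integral_add, simp_all only: Bochner_Integration.integrable_diff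
            Bochner_Integration.integral_diff)
    also have "(LINT u|circ. Re ((cnj (c M) / pi) * (r M u * cis (of_int (int M) * u)))) = (cmod (c M))\<^sup>2 / pi"
    proof -
      have "(LINT u|circ. Re ((cnj (c M) / pi) * (r M u * cis (of_int (int M) * u)))) =
         Re ((cnj (c M) / pi) * (LINT u|circ. r M u * cis (of_int (int M) * u)))"
        by (subst integral_Re) (intro int_rc, simp)
      also have "\<dots> = Re ((cnj (c M) / pi) * c M)" unfolding coeff ..
      also have "\<dots> = (cmod (c M))\<^sup>2 / pi"
        unfolding cmod_power2 by (simp add: power2_eq_square field_simps)
      finally show ?thesis .
    qed
    also have "(LINT u|circ. (cmod (c M))\<^sup>2 / (4 * pi\<^sup>2)) = (cmod (c M))\<^sup>2 / (2 * pi)"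
      using meas by (simp add: power2_eq_square)
    also have "(cmod (c M))\<^sup>2 / pi = 2 * ((cmod (c M))\<^sup>2 / (2 * pi))" by simp
    finally show ?case unfolding Suc.IH sum.lessThan_Suc add_divide_distrib by linarith
  qed
  moreover have "0 \<le> (LINT u|circ. (cmod (r M u))\<^sup>2)" by simp
  ultimately have "(\<Sum>m<M. (cmod (c m))\<^sup>2) / (2 * pi) \<le> (LINT u|circ. (cmod (h u))\<^sup>2)" by linarith
  then show ?thesis by (simp add: field_simps)
qed

lemma riemann_lebesgue_bounded:
  fixes h :: "real \<Rightarrow> complex"
  assumes [measurable]: "h \<in> borel_measurable borel" and bd: "\<And>u. cmod (h u) \<le> B"
  shows "(\<lambda>m::nat. LINT u|circ. h u * cis (of_nat m * u)) \<longlonglongrightarrow> 0"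
proof -
  define c where "c = (\<lambda>m::nat. LINT u|circ. h u * cis (of_nat m * u))"
  have "summable (\<lambda>m. (cmod (c m))\<^sup>2)"
    using bessel_circ[OF assms] by (intro summableI_nonneg_bounded) (auto simp: c_def)
  then have "(\<lambda>m. (cmod (c m))\<^sup>2) \<longlonglongrightarrow> 0" by (rule summable_LIMSEQ_zero)
  then have "(\<lambda>m. sqrt ((cmod (c m))\<^sup>2)) \<longlonglongrightarrow> sqrt 0" by (rule tendsto_real_sqrt)
  then show ?thesis unfolding c_def by (simp add: tendsto_norm_zero_iff)
qed

text \<open>The quotient in Chernoff's argument is controlled only by a multiple of
  \<open>1 / sqrt \<bar>u\<bar>\<close>, whose square is not integrable, so Bessel's inequality does
  not reach it. Truncation at height \<open>K\<close> gives a bounded function that is close in mean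
  by dominated convergence.\<close>

lemma riemann_lebesgue:
  fixes h :: "real \<Rightarrow> complex"
  assumes [measurable]: "h \<in> borel_measurable borel" and int: "integrable circ h"
  shows "(\<lambda>m::nat. LINT u|circ. h u * cis (of_nat m * u)) \<longlonglongrightarrow> 0"
proof (rule LIMSEQ_I)
  fix e :: real assume e: "e > 0"
  define t where "t K u = (if cmod (h u) \<le> real K then h u else 0)" for K u
  have [measurable]: "t K \<in> borel_measurable borel" for K unfolding t_def by measurable
  have [measurable]: "h \<in> borel_measurable circ" "t K \<in> borel_measurable circ"
     "(\<lambda>u. cis (of_nat m * u)) \<in> borel_measurable circ" for K m
    by (auto intro!: measurable_restrict_space1)
  have "(\<lambda>K. LINT u|circ. cmod (h u - t K u)) \<longlonglongrightarrow> (LINT u|circ. 0)"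
  proof (rule integral_dominated_convergence[where w="\<lambda>u. cmod (h u)"])
    show "integrable circ (\<lambda>u. cmod (h u))" using int by (rule integrable_norm)
    show "AE u in circ. (\<lambda>K. cmod (h u - t K u)) \<longlonglongrightarrow> 0"
    proof (rule AE_I2)
      fix u
      obtain K0 :: nat where "cmod (h u) \<le> real K0" using real_arch_simple by blast
      then have "cmod (h u - t K u) = 0" if "K \<ge> K0" for K
        using that by (simp add: t_def)
      then show "(\<lambda>K. cmod (h u - t K u)) \<longlonglongrightarrow> 0"
        by (intro tendsto_eventually) (auto simp: eventually_sequentially)
    qed
    show "AE u in circ. norm (cmod (h u - t K u)) \<le> cmod (h u)" for K
      by (rule AE_I2) (simp add: t_def)
  qed auto
  then have "(\<lambda>K. LINT u|circ. cmod (h u - t K u)) \<longlonglongrightarrow> 0" by simp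
  from LIMSEQ_D[OF this, of "e/2"] e obtain K where K: "(LINT u|circ. cmod (h u - t K u)) < e / 2"
    by fastforce
  have "\<And>u. cmod (t K u) \<le> real K" by (simp add: t_def)
  then have "(\<lambda>m::nat. LINT u|circ. t K u * cis (of_nat m * u)) \<longlonglongrightarrow> 0"
    by (intro riemann_lebesgue_bounded) auto
  from LIMSEQ_D[OF this, of "e / 2"] e
  obtain m0 where m0: "\<And>m. m \<ge> m0 \<Longrightarrow> cmod (LINT u|circ. t K u * cis (of_nat m * u)) < e / 2"
    by auto
  have int_t: "integrable circ (t K)"
    using int by (rule Bochner_Integration.integrable_bound) (auto simp: t_def)
  have int1: "integrable circ (\<lambda>u. g u * cis (of_nat m * u))" if "integrable circ g" for g and m::nat
    using that by (rule Bochner_Integration.integrable_bound)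
      (use that in \<open>auto simp: norm_mult intro!: borel_measurable_times\<close>)
  have "cmod (LINT u|circ. h u * cis (of_nat m * u)) < e" if "m \<ge> m0" for m
  proof -
    have "(LINT u|circ. h u * cis (of_nat m * u)) =
        (LINT u|circ. (h u - t K u) * cis (of_nat m * u)) + (LINT u|circ. t K u * cis (of_nat m * u))"
      using int1[OF int, of m] int1[OF int_t, of m] by (simp add: left_diff_distrib)
    moreover have "cmod (LINT u|circ. (h u - t K u) * cis (of_nat m * u)) \<le> (LINT u|circ. cmod (h u - t K u))"
      by (rule order_trans[OF integral_norm_bound]) (simp add: norm_mult)
    ultimately show ?thesis using K m0[OF that]
      by (smt (verit) norm_triangle_ineq field_sum_of_halves)
  qed
  then show "\<exists>m0. \<forall>m\<ge>m0. cmod ((LINT u|circ. h u * cis (of_nat m * u)) - 0) < e" by auto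
qed

lemma riemann_lebesgue_minus:
  fixes h :: "real \<Rightarrow> complex"
  assumes [measurable]: "h \<in> borel_measurable borel" and int: "integrable circ h"
  shows "(\<lambda>m::nat. LINT u|circ. h u * cis (- (of_nat m * u))) \<longlonglongrightarrow> 0"
proof -
  have m: "(\<lambda>u. cnj (h u)) \<in> borel_measurable borel"
    by (intro borel_measurable_continuous_on[where f=cnj] continuous_intros) auto
  have "integrable circ (\<lambda>u. cnj (h u))" using int by simp
  from tendsto_cnj[OF riemann_lebesgue[OF m this]] show ?thesis
    by (simp flip: Bochner_Integration.integral_cnj add: cis_cnj)
qed

section \<open>Pointwise convergence by Chernoff's argument\<close>

lemma half_le_sin:
  assumes "0 \<le> x" "x \<le> pi / 2" shows "x / 2 \<le> sin (x::real)"
proof -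
  \<comment> \<open>The Taylor bound \<open>\<bar>sin x - x\<bar> \<le> x ^ 3 / 6\<close> leaves
    \<open>x / 2\<close> as soon as \<open>x\<^sup>2 \<le> 3\<close>, which holds because
    \<open>pi / 2 < 1.6\<close>.\<close>
  have *: "x ^ 3 \<le> 3 * x"
  proof -
    have "x < 1.6" using assms pi_less_4 pi_approx by simp
    then have "x * x \<le> 1.6 * 1.6" using assms by (intro mult_mono) auto
    then have "x * (x * x) \<le> x * 3" using assms by (intro mult_left_mono) auto
    then show ?thesis by (simp add: power3_eq_cube mult.assoc)
  qed
  have "\<bar>sin x - (\<Sum>m<3. sin_coeff m * x ^ m)\<bar> \<le> inverse (fact 3) * \<bar>x\<bar> ^ 3"
    by (rule Maclaurin_sin_bound)
  then show ?thesis using assms *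
    by (simp add: sin_coeff_def eval_nat_numeral abs_if split: if_splits)
qed

lemma cmod_cis_diff_1: "cmod (cis t - 1) = 2 * \<bar>sin (t / 2)\<bar>"
  using dist_exp_i_1[of t] by (simp add: cis_conv_exp)

lemma sum_symmetric_telescope:
  fixes b :: "int \<Rightarrow> 'a::ab_group_add"
  shows "(\<Sum>m=-int M..int M. b (m + 1) - b m) = b (int M + 1) - b (- int M)"
proof (induction M)
  case (Suc M)
  have "{-int (Suc M)..int (Suc M)} = insert (int M + 1) (insert (- int M - 1) {-int M..int M})"
    by auto
  moreover have "- int (Suc M) = - int M - 1" "int (Suc M) = int M + 1" by auto
  ultimately show ?case using Suc.IH by (simp only:) (simp add: algebra_simps)
qed simp

text \<open>The majorant for the Chernoff quotient: a numerator of order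
  \<open>sqrt \<bar>u\<bar>\<close> over a denominator of order
  \<open>\<bar>u\<bar>\<close>.\<close>

lemma integrable_circ_inverse_sqrt: "integrable circ (\<lambda>u. 1 / sqrt \<bar>u\<bar>)"
proof -
  define F :: "real \<Rightarrow> real" where "F = (\<lambda>u. indicator {0..pi} u *\<^sub>R (u powr (-1/2)))"
  have [measurable]: "F \<in> borel_measurable borel" unfolding F_def by measurable
  have "(\<lambda>u. u powr (-1/2)) integrable_on {0..pi}"
    by (rule integrable_on_powr_from_0) auto
  then have "(\<lambda>u. u powr (-1/2)) absolutely_integrable_on {0..pi}"
    by (rule nonnegative_absolutely_integrable_1) auto
  then have "integrable lebesgue F" by (simp add: set_integrable_def F_def)
  then have 1: "integrable lborel F" by (simp add: integrable_completion)
  have 2: "integrable lborel (\<lambda>u. F (0 + (-1) * u))"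
    by (rule lborel_integrable_real_affine[OF 1]) simp
  have "integrable lborel (\<lambda>u. F u + F (0 + (-1) * u))"
    using 1 2 by (rule Bochner_Integration.integrable_add)
  \<comment> \<open>At \<open>u = 0\<close> the two sides agree through default values:
    \<open>0 powr (-1/2)\<close> and \<open>1 / sqrt 0\<close> are both 0.\<close>
  also have "(\<lambda>u. F u + F (0 + (-1) * u)) = (\<lambda>u. indicator {-pi..pi} u *\<^sub>R (1 / sqrt \<bar>u\<bar>))"
  proof
    fix u :: real
    have p: "v powr (-1/2) = 1 / sqrt v" if "v > 0" for v :: real
      using that powr_minus_divide[of v "1/2"] powr_half_sqrt[of v] by simp
    show "F u + F (0 + (-1) * u) = indicator {-pi..pi} u *\<^sub>R (1 / sqrt \<bar>u\<bar>)"
      using p[of u] p[of "-u"]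
      by (cases u "0::real" rule: linorder_cases) (auto simp: F_def indicator_def)
  qed
  finally show ?thesis by (simp add: integrable_restrict_space)
qed

lemma integral_circ_reflect:
  fixes f :: "real \<Rightarrow> complex"
  shows "(LINT u|circ. f (- u)) = (LINT u|circ. f u)"
proof -
  have "(LINT u|circ. f u) = \<bar>-1\<bar> *\<^sub>R (LINT u|lborel. indicator {-pi..pi} (0 + (-1) * u) *\<^sub>R f (0 + (-1) * u))"
    by (subst lborel_integral_real_affine[where c="-1" and t=0, symmetric])
       (auto simp: integral_restrict_space)
  also have "\<dots> = (LINT u|lborel. indicator {-pi..pi} u *\<^sub>R f (- u))"
    by (simp, intro Bochner_Integration.integral_cong refl) (auto simp: indicator_def)
  finally show ?thesis by (simp add: integral_restrict_space)
qed

text \<open>Symmetrising about 0 makes \<open>g\<close> small near 0 even at a jump of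
  \<open>f\<close>, provided that \<open>f 0\<close> is the mean of the one-sided limits. Dividing
  by \<open>cis u - 1\<close> turns each Fourier coefficient of \<open>g\<close> into a difference
  \<open>b (m + 1) - b m\<close>, so the symmetric sum collapses to two boundary coefficients. The
  exponent 1/2 in the hypothesis is the regularity that the kernel has at its edges.\<close>

lemma dini_chernoff:
  fixes f :: "real \<Rightarrow> complex"
  assumes meas[measurable]: "f \<in> borel_measurable borel" and bd: "\<And>u. cmod (f u) \<le> B"
    and "\<delta> > 0" and dini: "\<And>u. 0 < u \<Longrightarrow> u < \<delta> \<Longrightarrow> cmod (f u + f (- u) - 2 * f 0) \<le> C * sqrt u"
  shows "(\<lambda>M. \<Sum>m=-int M..int M. LINT u|circ. f u * cis (of_int m * u)) \<longlonglongrightarrow> 2 * pi * f 0"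
proof -
  define g where "g u = f u + f (- u) - 2 * f 0" for u
  define h where "h u = g u / (cis u - 1)" for u
  define b where "b m = (LINT u|circ. h u * cis (of_int m * u))" for m :: int
  \<comment> \<open>Beyond \<open>\<delta>\<close> the trivial bound \<open>4 * B\<close> is at most
    \<open>4 * B * sqrt (u / \<delta>)\<close>; adding this constant makes one estimate valid for
    all \<open>u\<close>.\<close>
  define C' where "C' = \<bar>C\<bar> + 4 * B / sqrt \<delta>"
  have [measurable]: "g \<in> borel_measurable borel" "h \<in> borel_measurable borel"
    unfolding g_def[abs_def] h_def[abs_def] by measurable
  have "B \<ge> 0" using bd[of 0] norm_ge_zero order_trans by blast
  have gbd4: "cmod (g u) \<le> 4 * B" for u
  proof -
    have "cmod (g u) \<le> cmod (f u) + cmod (f (-u)) + 2 * cmod (f 0)"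
      unfolding g_def using norm_triangle_ineq4[of "f u + f (- u)" "2 * f 0"] norm_triangle_ineq[of "f u" "f (- u)"]
      by (simp add: norm_mult)
    then show ?thesis using bd[of u] bd[of "-u"] bd[of 0] by linarith
  qed
  have gbd: "cmod (g u) \<le> C' * sqrt \<bar>u\<bar>" for u
  proof -
    have pos: "cmod (g u) \<le> C' * sqrt u" if "u > 0" for u
    proof (cases "u < \<delta>")
      case True
      then have "cmod (g u) \<le> C * sqrt u" using dini that by (simp add: g_def)
      also have "\<dots> \<le> C' * sqrt u" using that \<open>\<delta> > 0\<close> \<open>B \<ge> 0\<close>
        by (intro mult_right_mono) (auto simp: C'_def intro: add_increasing2)
      finally show ?thesis .
    next
      case False
      have "4 * B \<le> (4 * B / sqrt \<delta>) * sqrt u"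
      proof -
        have "sqrt \<delta> \<le> sqrt u" using False by simp
        then have "4 * B * 1 \<le> 4 * B * (sqrt u / sqrt \<delta>)" using \<open>\<delta> > 0\<close> \<open>B \<ge> 0\<close>
          by (intro mult_left_mono) (auto simp: field_simps)
        then show ?thesis by simp
      qed
      also have "\<dots> \<le> C' * sqrt u" using that by (intro mult_right_mono) (auto simp: C'_def)
      finally show ?thesis using gbd4[of u] by linarith
    qed
    have even: "g (- u) = g u" for u by (simp add: g_def)
    have "g 0 = 0" by (simp add: g_def)
    then show ?thesis using pos[of u] pos[of "-u"] even[of u]
      by (cases u "0::real" rule: linorder_cases) auto
  qed
  have int_h: "integrable circ h"
  proof (rule Bochner_Integration.integrable_bound)
    show "integrable circ (\<lambda>u. 2 * C' * (1 / sqrt \<bar>u\<bar>))"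
      by (intro integrable_mult_right integrable_circ_inverse_sqrt)
    show "h \<in> borel_measurable circ" by (intro measurable_restrict_space1) simp
    show "AE u in circ. norm (h u) \<le> norm (2 * C' * (1 / sqrt \<bar>u\<bar>))"
    proof (rule AE_I2)
      fix u assume "u \<in> space circ"
      then have u: "\<bar>u\<bar> \<le> pi" by (auto simp: space_restrict_space abs_le_iff)
      show "norm (h u) \<le> norm (2 * C' * (1 / sqrt \<bar>u\<bar>))"
      proof (cases "u = 0")
        case False
        have "\<bar>u\<bar> / 2 / 2 \<le> sin (\<bar>u\<bar> / 2)" using u by (intro half_le_sin) auto
        then have "\<bar>u\<bar> / 2 \<le> cmod (cis u - 1)"
          unfolding cmod_cis_diff_1 by (cases "u \<ge> 0") auto
        then have "cmod (h u) \<le> C' * sqrt \<bar>u\<bar> / (\<bar>u\<bar> / 2)"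
          unfolding h_def norm_divide using False gbd[of u]
          by (intro frac_le) (auto intro: order_trans[OF norm_ge_zero gbd])
        also have "\<dots> = 2 * C' * (1 / sqrt \<bar>u\<bar>)"
          using False by (simp add: field_simps flip: real_sqrt_mult)
        finally show ?thesis using abs_ge_self order_trans unfolding real_norm_def by blast
      qed (simp add: h_def)
    qed
  qed
  have int_hc: "integrable circ (\<lambda>u. h u * cis (of_int m * u))" for m
    using int_h by (rule Bochner_Integration.integrable_bound)
      (auto simp: norm_mult intro!: measurable_restrict_space1)
  have bd2: "cmod (f u) \<le> 2 * B" for u using bd[of u] \<open>B \<ge> 0\<close> by linarith
  have int_f: "integrable circ (\<lambda>u. f u * cis (of_int m * u))"
    "integrable circ (\<lambda>u. f (- u) * cis (of_int m * u))"
    "integrable circ (\<lambda>u. 2 * f 0 * cis (of_int m * u))" for m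
    by (auto intro!: integrable_circ_bounded[where B="2 * B"] simp: norm_mult bd bd2)
  have gh: "(LINT u|circ. g u * cis (of_int m * u)) = b (m + 1) - b m" for m
  proof -
    have "(LINT u|circ. g u * cis (of_int m * u)) =
       (LINT u|circ. h u * cis (of_int (m + 1) * u) - h u * cis (of_int m * u))"
    proof (rule Bochner_Integration.integral_cong[OF refl])
      fix u assume "u \<in> space circ"
      then have u: "\<bar>u\<bar> \<le> pi" by (auto simp: space_restrict_space abs_le_iff)
      \<comment> \<open>On \<open>[-pi, pi]\<close> the denominator vanishes only at 0, where
        \<open>h\<close> is 0 by division by zero and \<open>g\<close> vanishes as well.\<close>
      have "g u = h u * (cis u - 1)"
      proof (cases "u = 0")
        case False
        have "\<bar>u\<bar> / 2 / 2 \<le> sin (\<bar>u\<bar> / 2)" using u by (intro half_le_sin) auto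
        then have "\<bar>u\<bar> / 2 \<le> cmod (cis u - 1)"
          unfolding cmod_cis_diff_1 by (cases "u \<ge> 0") auto
        then have "cis u - 1 \<noteq> 0" using False by auto
        then show ?thesis by (simp add: h_def)
      qed (simp add: h_def g_def)
      moreover have "cis (of_int (m + 1) * u) = cis u * cis (of_int m * u)"
        by (simp add: cis_mult algebra_simps)
      ultimately show "g u * cis (of_int m * u) = h u * cis (of_int (m + 1) * u) - h u * cis (of_int m * u)"
        by (simp only:) (simp only: left_diff_distrib right_diff_distrib mult_1_right mult.assoc)
    qed
    also have "\<dots> = b (m + 1) - b m" unfolding b_def
      by (intro Bochner_Integration.integral_diff int_hc)
    finally show ?thesis .
  qed
  define S where "S M = (\<Sum>m=-int M..int M. LINT u|circ. f u * cis (of_int m * u))" for M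
  \<comment> \<open>\<open>f u\<close> and its reflection contribute \<open>S M\<close> each; of the
    constant \<open>2 * f 0\<close> only the mode \<open>m = 0\<close> survives.\<close>
  have gS: "(\<Sum>m=-int M..int M. LINT u|circ. g u * cis (of_int m * u)) = 2 * S M - 4 * pi * f 0" for M
  proof -
    have "(\<Sum>m=-int M..int M. LINT u|circ. g u * cis (of_int m * u)) =
      (\<Sum>m=-int M..int M. (LINT u|circ. f u * cis (of_int m * u)) + (LINT u|circ. f (- u) * cis (of_int m * u))
         - (LINT u|circ. 2 * f 0 * cis (of_int m * u)))"
      unfolding g_def left_diff_distrib distrib_right
      by (intro sum.cong refl) (simp add: int_f Bochner_Integration.integrable_add)
    also have "\<dots> = S M + (\<Sum>m=-int M..int M. LINT u|circ. f (- u) * cis (of_int m * u))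
        - (\<Sum>m=-int M..int M. LINT u|circ. 2 * f 0 * cis (of_int m * u))"
      by (simp add: sum.distrib sum_subtractf S_def)
    also have "(\<Sum>m=-int M..int M. LINT u|circ. f (- u) * cis (of_int m * u)) = S M"
      unfolding S_def
    proof (rule sum.reindex_bij_witness[where i=uminus and j=uminus])
      fix m :: int
      show "(LINT u|circ. f u * cis (of_int (- m) * u)) = (LINT u|circ. f (- u) * cis (of_int m * u))"
        using integral_circ_reflect[of "\<lambda>u. f u * cis (of_int (- m) * u)"] by simp
    qed auto
    also have "(\<Sum>m=-int M..int M. LINT u|circ. 2 * f 0 * cis (of_int m * u)) = 4 * pi * f 0"
      by (simp add: integral_circ_cis if_distrib[of "(*) _"] if_distrib[of complex_of_real] cong: if_cong)
    finally show ?thesis by simp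
  qed
  have "(\<lambda>M. b (int M + 1)) \<longlonglongrightarrow> 0"
    using LIMSEQ_Suc[OF riemann_lebesgue[OF _ int_h]] by (simp add: b_def add.commute)
  moreover have "(\<lambda>M. b (- int M)) \<longlonglongrightarrow> 0"
    using riemann_lebesgue_minus[OF _ int_h] by (simp add: b_def)
  ultimately have "(\<lambda>M. b (int M + 1) - b (- int M)) \<longlonglongrightarrow> 0 - 0" by (rule tendsto_diff)
  then have "(\<lambda>M. 2 * S M - 4 * pi * f 0) \<longlonglongrightarrow> 0"
    unfolding gS[symmetric] gh sum_symmetric_telescope by simp
  then have "(\<lambda>M. (2 * S M - 4 * pi * f 0) / 2 + 2 * pi * f 0) \<longlonglongrightarrow> 0 / 2 + 2 * pi * f 0"
    by (intro tendsto_intros) auto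
  moreover have "(2 * S M - 4 * pi * f 0) / 2 + 2 * pi * f 0 = S M" for M
    by (simp add: diff_divide_distrib)
  ultimately show ?thesis by (simp add: S_def)
qed

text \<open>The line is tiled by translates of \<open>[-pi, pi)\<close> centred at the points
  \<open>2 * pi * l\<close>. Integer characters are invariant under these translations, so the
  transform at an integer is a sum of Fourier coefficients and \<open>dini_chernoff\<close> applies
  cell by cell. Compact support keeps the number of cells finite, so limit and sum commute.\<close>

lemma poisson_compact_support:
  fixes q :: "real \<Rightarrow> complex"
  assumes meas[measurable]: "q \<in> borel_measurable borel" and bd: "\<And>u. cmod (q u) \<le> B"
    and supp: "\<And>u. \<bar>u\<bar> > R \<Longrightarrow> q u = 0"
    and dini: "\<And>l::int. \<exists>C. \<exists>\<delta>>0. \<forall>u. 0 < u \<and> u < \<delta> \<longrightarrow>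
        cmod (q (2 * pi * of_int l + u) + q (2 * pi * of_int l - u) - 2 * q (2 * pi * of_int l)) \<le> C * sqrt u"
  shows "(\<lambda>M. \<Sum>m=-int M..int M. LINT u|lborel. q u * cis (of_int m * u))
     \<longlonglongrightarrow> 2 * pi * (\<Sum>\<^sub>\<infinity>l::int. q (2 * pi * of_int l))"
proof -
  \<comment> \<open>Large enough that every cell meeting the support has an index of modulus at most
    \<open>L\<close>; the margin absorbs the half cell and the rounding.\<close>
  define L where "L = \<lceil>\<bar>R\<bar>\<rceil> + 2"
  define Q where "Q l u = q (2 * pi * of_int l + u)" for l :: int and u
  have [measurable]: "Q l \<in> borel_measurable borel" for l unfolding Q_def by measurable
  have split: "(LINT u|lborel. q u * cis (of_int m * u)) = (\<Sum>l=-L..L. LINT u|circ. Q l u * cis (of_int m * u))"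
    for m :: int
  proof -
    let ?J = "\<lambda>l::int. {2 * pi * of_int l - pi..<2 * pi * of_int l + pi}"
    have pt: "q u * cis (of_int m * u) = (\<Sum>l=-L..L. indicator (?J l) u *\<^sub>R (q u * cis (of_int m * u)))" for u
    proof (cases "\<bar>u\<bar> \<le> R")
      case True
      define l0 where "l0 = \<lfloor>(u + pi) / (2 * pi)\<rfloor>"
      have mem: "u \<in> ?J l \<longleftrightarrow> l0 = l" for l
        unfolding l0_def floor_eq_iff by (auto simp: field_simps)
      have "u \<in> ?J l0" using mem by simp
      then have "2 * pi * \<bar>of_int l0\<bar> \<le> \<bar>u\<bar> + pi"
        by (cases "l0 \<ge> 0") (auto simp: abs_if)
      also have "\<dots> \<le> \<bar>R\<bar> * pi + pi * 1"
      proof -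
        have "\<bar>R\<bar> * 1 \<le> \<bar>R\<bar> * pi" using pi_gt3 by (intro mult_left_mono) auto
        then show ?thesis using True by simp
      qed
      finally have "pi * (2 * \<bar>of_int l0\<bar>) \<le> pi * (\<bar>R\<bar> + 1)" by (simp add: algebra_simps)
      then have "2 * \<bar>of_int l0\<bar> \<le> \<bar>R\<bar> + 1" by (simp only: mult_le_cancel_left_pos pi_gt_zero)
      then have "l0 \<in> {-L..L}" unfolding L_def atLeastAtMost_iff by linarith
      moreover have "indicator (?J l) u *\<^sub>R z = (if l0 = l then z else 0)" for l and z :: complex
        using mem[of l] by (simp add: indicator_def del: atLeastLessThan_iff)
      ultimately show ?thesis by simp
    next
      case False then show ?thesis using supp by simp
    qed
    have int: "integrable lborel (\<lambda>u. indicator (?J l) u *\<^sub>R (q u * cis (of_int m * u)))" for l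
      by (rule integrableI_bounded_set_indicator[where B=B])
         (auto simp: norm_mult bd)
    have "(LINT u|lborel. q u * cis (of_int m * u)) =
        (LINT u|lborel. (\<Sum>l=-L..L. indicator (?J l) u *\<^sub>R (q u * cis (of_int m * u))))"
      by (subst pt) simp
    also have "\<dots> = (\<Sum>l=-L..L. LINT u|lborel. indicator (?J l) u *\<^sub>R (q u * cis (of_int m * u)))"
      by (intro Bochner_Integration.integral_sum int)
    also have "\<dots> = (\<Sum>l=-L..L. LINT u|circ. Q l u * cis (of_int m * u))"
    proof (intro sum.cong refl)
      fix l :: int
      have "(LINT u|lborel. indicator (?J l) u *\<^sub>R (q u * cis (of_int m * u))) =
        (LINT u|lborel. indicator (?J l) (2 * pi * of_int l + 1 * u) *\<^sub>R
          (q (2 * pi * of_int l + 1 * u) * cis (of_int m * (2 * pi * of_int l + 1 * u))))"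
        by (subst lborel_integral_real_affine[where c=1 and t="2 * pi * of_int l"]) auto
      also have "\<dots> = (LINT u|lborel. indicator {-pi..pi} u *\<^sub>R (Q l u * cis (of_int m * u)))"
      proof (rule integral_cong_AE)
        \<comment> \<open>The half-open cell and the closed interval of \<open>circ\<close> differ
          in one endpoint.\<close>
        have "AE u in lborel. u \<noteq> pi" by (rule AE_lborel_singleton)
        then show "AE u in lborel. indicator (?J l) (2 * pi * of_int l + 1 * u) *\<^sub>R
          (q (2 * pi * of_int l + 1 * u) * cis (of_int m * (2 * pi * of_int l + 1 * u))) =
            indicator {-pi..pi} u *\<^sub>R (Q l u * cis (of_int m * u))"
        proof eventually_elim
          case (elim u)
          have "cis (of_int m * (2 * pi * of_int l + 1 * u)) = cis (2 * pi * of_int (m * l)) * cis (of_int m * u)"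
            by (simp add: cis_mult algebra_simps)
          also have "cis (2 * pi * of_int (m * l)) = 1"
            by (intro cis_multiple_2pi) simp
          finally show ?case using elim by (auto simp: indicator_def Q_def)
        qed
      qed auto
      finally show "(LINT u|lborel. indicator (?J l) u *\<^sub>R (q u * cis (of_int m * u))) =
         (LINT u|circ. Q l u * cis (of_int m * u))"
        by (simp add: integral_restrict_space)
    qed
    finally show ?thesis .
  qed
  have "(\<lambda>M. \<Sum>l=-L..L. \<Sum>m=-int M..int M. LINT u|circ. Q l u * cis (of_int m * u))
      \<longlonglongrightarrow> (\<Sum>l=-L..L. 2 * pi * Q l 0)"
  proof (intro tendsto_sum)
    fix l
    obtain C \<delta> where "\<delta> > 0" and *: "\<And>u. 0 < u \<Longrightarrow> u < \<delta> \<Longrightarrow>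
      cmod (q (2 * pi * of_int l + u) + q (2 * pi * of_int l - u) - 2 * q (2 * pi * of_int l)) \<le> C * sqrt u"
      using dini[of l] by auto
    show "(\<lambda>M. \<Sum>m=-int M..int M. LINT u|circ. Q l u * cis (of_int m * u)) \<longlonglongrightarrow> 2 * pi * Q l 0"
      by (rule dini_chernoff[where B=B and \<delta>=\<delta> and C=C])
         (use bd \<open>\<delta> > 0\<close> * in \<open>auto simp: Q_def\<close>)
  qed
  also have "(\<lambda>M. \<Sum>l=-L..L. \<Sum>m=-int M..int M. LINT u|circ. Q l u * cis (of_int m * u)) =
     (\<lambda>M. \<Sum>m=-int M..int M. LINT u|lborel. q u * cis (of_int m * u))"
    unfolding split by (intro ext sum.swap)
  also have "(\<Sum>l=-L..L. 2 * pi * Q l 0) = 2 * pi * (\<Sum>l=-L..L. q (2 * pi * of_int l))"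
    by (simp add: Q_def sum_distrib_left)
  also have "(\<Sum>l=-L..L. q (2 * pi * of_int l)) = (\<Sum>\<^sub>\<infinity>l::int. q (2 * pi * of_int l))"
  proof -
    have "(\<Sum>\<^sub>\<infinity>l\<in>{-L..L}. q (2 * pi * of_int l)) = (\<Sum>\<^sub>\<infinity>l::int. q (2 * pi * of_int l))"
    proof (rule infsum_cong_neutral)
      fix l :: int assume "l \<in> UNIV - {-L..L}"
      then have "\<bar>of_int l\<bar> > \<bar>R\<bar>" unfolding L_def by (simp add: abs_if split: if_splits) linarith+
      moreover have "\<bar>of_int l\<bar> * 1 \<le> \<bar>of_int l\<bar> * (2 * pi)" using pi_gt3 by (intro mult_left_mono) auto
      ultimately have "\<bar>2 * pi * of_int l\<bar> > R" unfolding abs_mult by (simp add: mult.commute)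
      then show "q (2 * pi * of_int l) = 0" by (rule supp)
    qed auto
    then show ?thesis by simp
  qed
  finally show ?thesis .
qed

section \<open>The kernel\<close>

text \<open>The sign of \<open>\<kappa>\<close> is left free because both \<open>\<beta>\<close> and
  \<open>- \<beta>\<close> occur. For either sign the inner limit at the edges is 1, so 1/2 is the
  averaged value.\<close>

definition cap :: "real \<Rightarrow> real \<Rightarrow> real" where
  "cap \<kappa> z = (if \<bar>z\<bar> < 1 then exp (\<kappa> * sqrt (1 - z\<^sup>2)) else if \<bar>z\<bar> = 1 then 1 / 2 else 0)"

lemma cap_measurable [measurable]: "cap \<kappa> \<in> borel_measurable borel"
  unfolding cap_def[abs_def] by measurable

lemma cap_minus [simp]: "cap \<kappa> (- z) = cap \<kappa> z"
  by (simp add: cap_def)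

lemma cap_nonneg: "0 \<le> cap \<kappa> z"
  by (simp add: cap_def)

lemma cap_eq_0: "\<bar>z\<bar> > 1 \<Longrightarrow> cap \<kappa> z = 0"
  by (simp add: cap_def)

lemma cap_le: "cap \<kappa> z \<le> exp \<bar>\<kappa>\<bar>"
proof -
  have "\<kappa> * sqrt (1 - z\<^sup>2) \<le> \<bar>\<kappa>\<bar>" if "\<bar>z\<bar> < 1"
  proof -
    have "sqrt (1 - z\<^sup>2) \<le> 1" "0 \<le> sqrt (1 - z\<^sup>2)" using that by (auto simp: abs_square_le_1)
    then have "\<bar>\<kappa>\<bar> * sqrt (1 - z\<^sup>2) \<le> \<bar>\<kappa>\<bar> * 1" "\<kappa> * sqrt (1 - z\<^sup>2) \<le> \<bar>\<kappa>\<bar> * sqrt (1 - z\<^sup>2)"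
      by (intro mult_left_mono mult_right_mono; simp)+
    then show ?thesis by simp
  qed
  moreover have "1 / 2 \<le> exp \<bar>\<kappa>\<bar>" using one_le_exp_iff[of "\<bar>\<kappa>\<bar>"] by linarith
  ultimately show ?thesis by (auto simp: cap_def)
qed

lemma cap_le_1: "\<kappa> \<le> 0 \<Longrightarrow> cap \<kappa> z \<le> indicator {-1..1} z"
  by (auto simp: cap_def indicator_def abs_le_iff abs_less_iff mult_nonpos_nonneg abs_square_le_1)

lemma psi_eq_cap:
  assumes "n \<ge> 1" "w \<ge> 1"
  shows "psi n w \<beta> x = exp (- \<beta>) * cap \<beta> (real n * x / (pi * real w))"
proof -
  have pos: "real n > 0" "pi * real w > 0" using assms by auto
  have "\<bar>x\<bar> = pi * real w / real n \<longleftrightarrow> \<bar>real n * x / (pi * real w)\<bar> = 1"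
    using pos assms by (simp add: abs_mult field_simps) (auto simp: mult.commute)
  then show ?thesis
    by (auto simp: psi_def es_kernel_def cap_def right_diff_distrib simp flip: exp_add)
qed

section \<open>Regularity of the kernel at its edges\<close>

lemma abs_sqrt_diff_le:
  assumes "0 \<le> a" "0 \<le> b" shows "\<bar>sqrt a - sqrt b\<bar> \<le> sqrt \<bar>a - b\<bar>"
proof (rule real_le_rsqrt)
  have "\<bar>sqrt a - sqrt b\<bar>\<^sup>2 \<le> \<bar>sqrt a - sqrt b\<bar> * (sqrt a + sqrt b)"
    unfolding power2_eq_square using assms by (intro mult_left_mono) (auto simp: abs_le_iff)
  also have "\<dots> = \<bar>(sqrt a - sqrt b) * (sqrt a + sqrt b)\<bar>"
    using assms by (simp add: abs_mult)
  also have "(sqrt a - sqrt b) * (sqrt a + sqrt b) = a - b"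
    using assms by (simp add: algebra_simps)
  finally show "\<bar>sqrt a - sqrt b\<bar>\<^sup>2 \<le> \<bar>a - b\<bar>" .
qed

lemma abs_exp_diff_le:
  fixes a b c :: real
  assumes "a \<le> c" "b \<le> c" shows "\<bar>exp a - exp b\<bar> \<le> exp c * \<bar>a - b\<bar>"
proof -
  have *: "exp a - exp b \<le> exp c * (a - b)" if "b \<le> a" "a \<le> c" for a b
  proof -
    have "exp a * (1 + (b - a)) \<le> exp a * exp (b - a)"
      by (intro mult_left_mono exp_ge_add_one_self) auto
    then have "exp a - exp b \<le> exp a * (a - b)"
      by (simp add: algebra_simps flip: exp_add)
    also have "\<dots> \<le> exp c * (a - b)" using that by (intro mult_right_mono) auto
    finally show ?thesis .
  qed
  show ?thesis using *[of a b] *[of b a] assms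
    by (cases "b \<le> a") (auto simp: abs_if)
qed

text \<open>The slope of the semicircle is unbounded at \<open>\<plusminus>1\<close>, so a Lipschitz
  bound fails there. The factor \<open>y - z\<close> of \<open>y\<^sup>2 - z\<^sup>2\<close> passes
  through the Hoelder bound for \<open>sqrt\<close>; the other factor is estimated by 4 so that its
  root is the integer 2.\<close>

lemma exp_semicircle_hoelder:
  assumes "\<bar>y\<bar> \<le> 1" "\<bar>z\<bar> \<le> 1"
  shows "\<bar>exp (\<kappa> * sqrt (1 - y\<^sup>2)) - exp (\<kappa> * sqrt (1 - z\<^sup>2))\<bar> \<le> 2 * exp \<bar>\<kappa>\<bar> * \<bar>\<kappa>\<bar> * sqrt \<bar>y - z\<bar>"
proof -
  have sq: "0 \<le> 1 - y\<^sup>2" "0 \<le> 1 - z\<^sup>2" using assms by (auto simp: abs_square_le_1)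
  have "\<kappa> * sqrt (1 - v\<^sup>2) \<le> \<bar>\<kappa>\<bar>" if "\<bar>v\<bar> \<le> 1" for v
  proof -
    have "\<bar>\<kappa>\<bar> * sqrt (1 - v\<^sup>2) \<le> \<bar>\<kappa>\<bar> * 1" using that by (intro mult_left_mono) auto
    moreover have "\<kappa> * sqrt (1 - v\<^sup>2) \<le> \<bar>\<kappa>\<bar> * sqrt (1 - v\<^sup>2)"
      using that by (intro mult_right_mono) (auto simp: abs_square_le_1)
    ultimately show ?thesis by linarith
  qed
  then have "\<bar>exp (\<kappa> * sqrt (1 - y\<^sup>2)) - exp (\<kappa> * sqrt (1 - z\<^sup>2))\<bar>
      \<le> exp \<bar>\<kappa>\<bar> * \<bar>\<kappa> * sqrt (1 - y\<^sup>2) - \<kappa> * sqrt (1 - z\<^sup>2)\<bar>"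
    by (intro abs_exp_diff_le) (use assms in auto)
  also have "\<dots> = exp \<bar>\<kappa>\<bar> * \<bar>\<kappa>\<bar> * \<bar>sqrt (1 - y\<^sup>2) - sqrt (1 - z\<^sup>2)\<bar>"
    by (simp add: abs_mult flip: right_diff_distrib)
  also have "\<dots> \<le> exp \<bar>\<kappa>\<bar> * \<bar>\<kappa>\<bar> * (2 * sqrt \<bar>y - z\<bar>)"
  proof (intro mult_left_mono)
    have "\<bar>(1 - y\<^sup>2) - (1 - z\<^sup>2)\<bar> = \<bar>y - z\<bar> * \<bar>y + z\<bar>"
      by (simp add: power2_eq_square algebra_simps flip: abs_mult)
    also have "\<dots> \<le> \<bar>y - z\<bar> * 4" using assms by (intro mult_left_mono) auto
    finally have "sqrt \<bar>(1 - y\<^sup>2) - (1 - z\<^sup>2)\<bar> \<le> sqrt (\<bar>y - z\<bar> * 4)" by (rule real_sqrt_le_mono)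
    also have "\<dots> = 2 * sqrt \<bar>y - z\<bar>" by (simp add: real_sqrt_mult)
    finally show "\<bar>sqrt (1 - y\<^sup>2) - sqrt (1 - z\<^sup>2)\<bar> \<le> 2 * sqrt \<bar>y - z\<bar>"
      using abs_sqrt_diff_le[OF sq] by linarith
  qed auto
  finally show ?thesis by (simp add: mult_ac)
qed

text \<open>Away from the edges \<open>\<delta>\<close> keeps both points on the same side of the
  edges as \<open>z\<close>. At an edge one of the two values is 0 and the other is near 1, which is
  twice the assigned 1/2: here the averaging convention enters.\<close>

lemma cap_dini:
  "\<exists>C\<ge>0. \<exists>\<delta>>0. \<forall>u. 0 < u \<and> u < \<delta> \<longrightarrow> \<bar>cap \<kappa> (z + u) + cap \<kappa> (z - u) - 2 * cap \<kappa> z\<bar> \<le> C * sqrt u"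
proof -
  define C where "C = 2 * exp \<bar>\<kappa>\<bar> * \<bar>\<kappa>\<bar>"
  have C0: "0 \<le> C" by (simp add: C_def)
  have H: "\<bar>exp (\<kappa> * sqrt (1 - y\<^sup>2)) - exp (\<kappa> * sqrt (1 - v\<^sup>2))\<bar> \<le> C * sqrt \<bar>y - v\<bar>"
    if "\<bar>y\<bar> \<le> 1" "\<bar>v\<bar> \<le> 1" for y v
    using exp_semicircle_hoelder[OF that, of \<kappa>] unfolding C_def .
  consider (inside) "\<bar>z\<bar> < 1" | (outside) "\<bar>z\<bar> > 1" | (one) "\<bar>z\<bar> = 1" by linarith
  then show ?thesis
  proof cases
    case inside
    have "\<bar>cap \<kappa> (z + u) + cap \<kappa> (z - u) - 2 * cap \<kappa> z\<bar> \<le> 2 * C * sqrt u" if "0 < u" "u < 1 - \<bar>z\<bar>" for u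
    proof -
      have "\<bar>z + u\<bar> < 1" "\<bar>z - u\<bar> < 1" using that by linarith+
      then show ?thesis using H[of "z + u" z] H[of "z - u" z] inside that by (simp add: cap_def)
    qed
    then show ?thesis using inside C0 by (intro exI[of _ "2 * C"] conjI exI[of _ "1 - \<bar>z\<bar>"]) auto
  next
    case outside
    have "cap \<kappa> (z + u) = 0" "cap \<kappa> (z - u) = 0" if "0 < u" "u < \<bar>z\<bar> - 1" for u
      using that by (intro cap_eq_0; linarith)+
    then show ?thesis using outside by (intro exI[of _ 0] conjI exI[of _ "\<bar>z\<bar> - 1"]) (auto simp: cap_eq_0)
  next
    case one
    have pos: "\<bar>cap \<kappa> (1 + u) + cap \<kappa> (1 - u) - 2 * cap \<kappa> 1\<bar> \<le> C * sqrt u" if "0 < u" "u < 1" for u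
      using H[of "1 - u" 1] that by (simp add: cap_def)
    have "\<bar>cap \<kappa> (z + u) + cap \<kappa> (z - u) - 2 * cap \<kappa> z\<bar> \<le> C * sqrt u" if "0 < u" "u < 1" for u
    proof (cases "z = 1")
      case False
      then have z: "z = - 1" using one by auto
      have "cap \<kappa> (z + u) = cap \<kappa> (1 - u)" "cap \<kappa> (z - u) = cap \<kappa> (1 + u)" "cap \<kappa> z = cap \<kappa> 1"
        using cap_minus[of \<kappa> "1 - u"] cap_minus[of \<kappa> "1 + u"] cap_minus[of \<kappa> 1] unfolding z by (auto simp: algebra_simps)
      then show ?thesis using pos[OF that] by (simp add: add.commute)
    qed (use pos that in auto)
    then show ?thesis using C0 by (intro exI[of _ C] conjI exI[of _ 1]) auto
  qed
qed

text \<open>With \<open>cis (c * p)\<close> pulled out, the modulation differs from 1 by at most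
  \<open>\<bar>c\<bar> * u\<close> at each point, and \<open>u \<le> sqrt u\<close> for
  \<open>u \<le> 1\<close>. The rest is \<open>cap_dini\<close> rescaled by
  \<open>s\<close>.\<close>

lemma cap_modulated_dini:
  fixes a c s p \<kappa> :: real
  assumes "s > 0"
  defines "q \<equiv> \<lambda>u. complex_of_real (cap \<kappa> ((u - a) / s)) * cis (c * u)"
  shows "\<exists>C. \<exists>\<delta>>0. \<forall>u. 0 < u \<and> u < \<delta> \<longrightarrow> cmod (q (p + u) + q (p - u) - 2 * q p) \<le> C * sqrt u"
proof -
  define z where "z = (p - a) / s"
  obtain C \<delta> where C: "C \<ge> 0" "\<delta> > 0"
    "\<And>u. 0 < u \<Longrightarrow> u < \<delta> \<Longrightarrow> \<bar>cap \<kappa> (z + u) + cap \<kappa> (z - u) - 2 * cap \<kappa> z\<bar> \<le> C * sqrt u"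
    using cap_dini[of \<kappa> z] by auto
  define D where "D = C * sqrt (1 / s) + 2 * exp \<bar>\<kappa>\<bar> * \<bar>c\<bar>"
  have "cmod (q (p + u) + q (p - u) - 2 * q p) \<le> D * sqrt u" if "0 < u" "u < min 1 (\<delta> * s)" for u
  proof -
    have zz: "(p + u - a) / s = z + u / s" "(p - u - a) / s = z - u / s"
      by (simp_all add: z_def add_divide_distrib diff_divide_distrib)
    define K0 K1 K2 where "K0 = cap \<kappa> z" "K1 = cap \<kappa> (z + u / s)" "K2 = cap \<kappa> (z - u / s)"
    have eq: "q (p + u) + q (p - u) - 2 * q p =
      cis (c * p) * (of_real (K1 + K2 - 2 * K0) + of_real K1 * (cis (c * u) - 1) + of_real K2 * (cis (- (c * u)) - 1))"
    proof -
      have "cis (c * (p + u)) = cis (c * p) * cis (c * u)" "cis (c * (p - u)) = cis (c * p) * cis (- (c * u))"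
        by (simp_all add: cis_mult algebra_simps)
      then show ?thesis
        unfolding q_def zz K0_K1_K2_def z_def[symmetric]
        by (simp only: of_real_add of_real_diff of_real_mult of_real_numeral) (simp add: ring_distribs mult_ac)
    qed
    have cis: "cmod (cis t - 1) \<le> \<bar>t\<bar>" for t
      using abs_sin_x_le_abs_x[of "t / 2"] by (simp add: cmod_cis_diff_1)
    have "u \<le> sqrt u"
      using that by (intro real_le_rsqrt) (simp add: power2_eq_square mult_left_le)
    have b: "cmod (of_real K * (cis t - 1)) \<le> exp \<bar>\<kappa>\<bar> * (\<bar>c\<bar> * sqrt u)"
      if "\<bar>t\<bar> = \<bar>c\<bar> * u" "0 \<le> K" "K \<le> exp \<bar>\<kappa>\<bar>" for t K
    proof -
      have "cmod (cis t - 1) \<le> \<bar>c\<bar> * sqrt u"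
        using cis[of t] that(1) mult_left_mono[OF \<open>u \<le> sqrt u\<close>, of "\<bar>c\<bar>"] by linarith
      then show ?thesis using that by (auto simp: norm_mult intro!: mult_mono)
    qed
    have "cmod (q (p + u) + q (p - u) - 2 * q p) \<le> \<bar>K1 + K2 - 2 * K0\<bar> +
       exp \<bar>\<kappa>\<bar> * (\<bar>c\<bar> * sqrt u) + exp \<bar>\<kappa>\<bar> * (\<bar>c\<bar> * sqrt u)"
      unfolding eq norm_mult norm_cis mult_1
      by (intro norm_triangle_le add_mono b)
         (use that in \<open>auto simp: K0_K1_K2_def cap_nonneg cap_le abs_mult simp flip: of_real_add of_real_diff
            simp del: of_real_add of_real_diff\<close>)
    also have "\<bar>K1 + K2 - 2 * K0\<bar> \<le> C * sqrt (u / s)"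
      unfolding K0_K1_K2_def using that assms(1) by (intro C(3)) (auto simp: field_simps)
    also have "sqrt (u / s) = sqrt (1 / s) * sqrt u" by (simp flip: real_sqrt_mult)
    finally show ?thesis by (simp add: D_def algebra_simps)
  qed
  then show ?thesis using C(2) assms(1) by (intro exI[of _ D] exI[of _ "min 1 (\<delta> * s)"]) auto
qed

text \<open>The substitution \<open>u = n * x + pi * w * z\<close> stretches the grid
  \<open>2 * pi * l / n\<close> to \<open>2 * pi * l\<close> and shrinks the spacing
  \<open>n\<close> of the alias frequencies to 1. The fraction \<open>k / n\<close> remains as a
  modulation, and the shift by \<open>n * x\<close> produces the phase in \<open>x\<close>.\<close>

lemma cap_poisson:
  fixes n w :: nat and k :: int and x \<kappa> :: real
  assumes n: "n \<ge> 1" and w: "w \<ge> 1"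
  shows "(\<lambda>M. \<Sum>m=-int M..int M. fourier (cap \<kappa>) (pi * real w * (of_int m + of_int k / real n)) *
            cis (of_int (k + m * int n) * x))
    \<longlonglongrightarrow> 2 / of_nat w *
          (\<Sum>\<^sub>\<infinity>l::int. complex_of_real (cap \<kappa> ((2 * pi * of_int l - real n * x) / (pi * real w))) *
                      cis (of_int k / real n * (2 * pi * of_int l)))"
proof -
  define s where "s = pi * real w"
  have s: "s > 0" using w by (simp add: s_def)
  define q where "q u = complex_of_real (cap \<kappa> ((u - real n * x) / s)) * cis (of_int k / real n * u)" for u
  have "(\<lambda>M. \<Sum>m=-int M..int M. LINT u|lborel. q u * cis (of_int m * u))
     \<longlonglongrightarrow> 2 * pi * (\<Sum>\<^sub>\<infinity>l::int. q (2 * pi * of_int l))"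
  proof (rule poisson_compact_support[where B="exp \<bar>\<kappa>\<bar>" and R="\<bar>real n * x\<bar> + s"])
    show "q \<in> borel_measurable borel" unfolding q_def[abs_def] by measurable
    show "cmod (q u) \<le> exp \<bar>\<kappa>\<bar>" for u
      by (simp add: q_def norm_mult cap_nonneg cap_le)
    show "q u = 0" if "\<bar>real n * x\<bar> + s < \<bar>u\<bar>" for u
    proof -
      have "\<bar>u - real n * x\<bar> > s" using that by linarith
      then have "\<bar>(u - real n * x) / s\<bar> > 1" using s by (simp add: field_simps)
      then show ?thesis by (simp add: q_def cap_eq_0)
    qed
    show "\<exists>C. \<exists>\<delta>>0. \<forall>u. 0 < u \<and> u < \<delta> \<longrightarrow>
       cmod (q (2 * pi * of_int l + u) + q (2 * pi * of_int l - u) - 2 * q (2 * pi * of_int l)) \<le> C * sqrt u" for l :: int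
      unfolding q_def by (rule cap_modulated_dini[OF s])
  qed
  then have "(\<lambda>M. 1 / of_real s * (\<Sum>m=-int M..int M. LINT u|lborel. q u * cis (of_int m * u)))
     \<longlonglongrightarrow> 1 / of_real s * (2 * pi * (\<Sum>\<^sub>\<infinity>l::int. q (2 * pi * of_int l)))"
    by (intro tendsto_mult tendsto_const)
  moreover have "1 / of_real s * (LINT u|lborel. q u * cis (of_int m * u)) =
      fourier (cap \<kappa>) (pi * real w * (of_int m + of_int k / real n)) * cis (of_int (k + m * int n) * x)" for m
  proof -
    have "(LINT u|lborel. q u * cis (of_int m * u)) =
       \<bar>s\<bar> *\<^sub>R (LINT z|lborel. q (real n * x + s * z) * cis (of_int m * (real n * x + s * z)))"
      using s by (subst lborel_integral_real_affine[where c=s and t="real n * x"]) auto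
    also have "(\<lambda>z. q (real n * x + s * z) * cis (of_int m * (real n * x + s * z))) =
       (\<lambda>z. (complex_of_real (cap \<kappa> z) * cis (pi * real w * (of_int m + of_int k / real n) * z)) *
          cis (of_int (k + m * int n) * x))"
    proof
      fix z
      have "cis (of_int k / real n * (real n * x + s * z)) * cis (of_int m * (real n * x + s * z)) =
        cis (pi * real w * (of_int m + of_int k / real n) * z) * cis (of_int (k + m * int n) * x)"
        unfolding cis_mult using n by (intro arg_cong[where f=cis]) (simp add: s_def field_simps)
      then show "q (real n * x + s * z) * cis (of_int m * (real n * x + s * z)) =
       (complex_of_real (cap \<kappa> z) * cis (pi * real w * (of_int m + of_int k / real n) * z)) *
          cis (of_int (k + m * int n) * x)"
        using s by (simp add: q_def mult.assoc)
    qed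
    finally show ?thesis using s by (simp add: fourier_def scaleR_conv_of_real)
  qed
  moreover have "1 / of_real s * (2 * pi * (\<Sum>\<^sub>\<infinity>l::int. q (2 * pi * of_int l))) =
     2 / of_nat w * (\<Sum>\<^sub>\<infinity>l::int. q (2 * pi * of_int l))"
    using w by (simp add: s_def)
  ultimately show ?thesis by (simp add: q_def s_def sum_distrib_left)
qed

section \<open>Reduction to a real cosine transform\<close>

lemma fourier_psi:
  assumes "n \<ge> 1" "w \<ge> 1"
  shows "fourier (psi n w \<beta>) \<xi> = of_real (pi * real w / real n * exp (- \<beta>)) * fourier (cap \<beta>) (pi * real w * \<xi> / real n)"
proof -
  define s where "s = pi * real w / real n"
  have s: "s > 0" using assms by (simp add: s_def)
  have "fourier (psi n w \<beta>) \<xi> = \<bar>s\<bar> *\<^sub>R (LINT z|lborel. complex_of_real (psi n w \<beta> (0 + s * z)) * cis (\<xi> * (0 + s * z)))"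
    unfolding fourier_def using s by (intro lborel_integral_real_affine) auto
  also have "(\<lambda>z. complex_of_real (psi n w \<beta> (0 + s * z)) * cis (\<xi> * (0 + s * z))) =
     (\<lambda>z. of_real (exp (- \<beta>)) * (complex_of_real (cap \<beta> z) * cis ((pi * real w * \<xi> / real n) * z)))"
  proof
    fix z
    have "real n * (s * z) / (pi * real w) = z" using assms by (simp add: s_def)
    moreover have "\<xi> * (s * z) = pi * real w * \<xi> / real n * z" by (simp add: s_def)
    ultimately show "complex_of_real (psi n w \<beta> (0 + s * z)) * cis (\<xi> * (0 + s * z)) =
       of_real (exp (- \<beta>)) * (complex_of_real (cap \<beta> z) * cis ((pi * real w * \<xi> / real n) * z))"
      using assms by (simp add: psi_eq_cap)
  qed
  finally show ?thesis using s by (simp add: fourier_def s_def scaleR_conv_of_real)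
qed

definition cap_cos :: "real \<Rightarrow> real \<Rightarrow> real" where
  "cap_cos \<kappa> \<rho> = (LINT z|lborel. cap \<kappa> z * cos (\<rho> * z))"

lemma integrable_cap_mult:
  fixes f :: "real \<Rightarrow> 'a::{banach, second_countable_topology, real_normed_field}"
  assumes [measurable]: "f \<in> borel_measurable borel" and bd: "\<And>z. norm (f z) \<le> 1"
  shows "integrable lborel (\<lambda>z. of_real (cap \<kappa> z) * f z)"
proof -
  have "integrable lborel (\<lambda>z. indicator {-1..1} z *\<^sub>R (of_real (cap \<kappa> z) * f z))"
  proof (rule integrableI_bounded_set_indicator[where B="exp \<bar>\<kappa>\<bar>"])
    show "AE z in lborel. z \<in> {-1..1} \<longrightarrow> norm (of_real (cap \<kappa> z) * f z) \<le> exp \<bar>\<kappa>\<bar>"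
      using bd by (auto simp: norm_mult cap_nonneg intro!: AE_I2 order_trans[OF mult_mono[OF cap_le bd]])
  qed auto
  also have "(\<lambda>z. indicator {-1..1} z *\<^sub>R (of_real (cap \<kappa> z) * f z)) = (\<lambda>z. of_real (cap \<kappa> z) * f z)"
    by (auto simp: fun_eq_iff indicator_def cap_eq_0)
  finally show ?thesis .
qed

lemma fourier_cap: "fourier (cap \<kappa>) \<rho> = of_real (cap_cos \<kappa> \<rho>)"
proof -
  have int: "integrable lborel (\<lambda>z. complex_of_real (cap \<kappa> z) * cis (\<rho> * z))"
    by (intro integrable_cap_mult) auto
  have "fourier (cap \<kappa>) \<rho> = (LINT z|lborel. complex_of_real (cap \<kappa> z) * cis (\<rho> * (0 + (-1) * z)))"
    unfolding fourier_def
    by (subst lborel_integral_real_affine[where c="-1" and t=0]) auto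
  then have "fourier (cap \<kappa>) \<rho> = cnj (fourier (cap \<kappa>) \<rho>)"
    unfolding fourier_def by (simp flip: Bochner_Integration.integral_cnj add: cis_cnj)
  then have "Im (fourier (cap \<kappa>) \<rho>) = 0" by (simp add: complex_eq_iff)
  moreover have "Re (fourier (cap \<kappa>) \<rho>) = cap_cos \<kappa> \<rho>"
    unfolding fourier_def cap_cos_def by (subst integral_Re[symmetric]) (use int in auto)
  ultimately show ?thesis by (simp add: complex_eq_iff)
qed

lemma abs_cap_cos_le:
  assumes "\<kappa> \<le> 0" shows "\<bar>cap_cos \<kappa> \<rho>\<bar> \<le> 2"
proof -
  have "\<bar>cap_cos \<kappa> \<rho>\<bar> \<le> (LINT z|lborel. \<bar>cap \<kappa> z * cos (\<rho> * z)\<bar>)"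
    unfolding cap_cos_def by (rule integral_abs_bound)
  also have "\<dots> \<le> (LINT z|lborel. indicator {-1..1::real} z)"
  proof (rule integral_mono)
    show "integrable lborel (\<lambda>z. \<bar>cap \<kappa> z * cos (\<rho> * z)\<bar>)"
      using integrable_cap_mult[of "\<lambda>z. cos (\<rho> * z)" \<kappa>] by (intro integrable_abs) simp
    show "\<bar>cap \<kappa> z * cos (\<rho> * z)\<bar> \<le> indicator {-1..1} z" for z
      using cap_le_1[OF assms, of z] cap_nonneg[of \<kappa> z] mult_mono[of "\<bar>cap \<kappa> z\<bar>" "indicator {-1..1} z" "\<bar>cos (\<rho> * z)\<bar>" 1]
      by (simp add: abs_mult)
  qed auto
  finally show ?thesis by simp
qed

section \<open>The transform of the odd part\<close>

text \<open>Substituting \<open>z = sin \<theta>\<close> removes the square root, which becomes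
  \<open>cos \<theta> \<ge> 0\<close> on this range. The averaged values at the edges sit on a null
  set.\<close>

lemma cap_cos_eq_integral:
  "cap_cos \<kappa> \<rho> = integral {- (pi / 2)..pi / 2} (\<lambda>\<theta>. exp (\<kappa> * cos \<theta>) * cos (\<rho> * sin \<theta>) * cos \<theta>)"
proof -
  define f where "f z = exp (\<kappa> * sqrt (1 - z\<^sup>2)) * cos (\<rho> * z)" for z :: real
  have contf: "continuous_on {-1..1} f"
    unfolding f_def by (intro continuous_intros)
  have "cap_cos \<kappa> \<rho> = (LINT z:{-1..1}|lborel. f z)"
    unfolding cap_cos_def set_lebesgue_integral_def
  proof (rule integral_cong_AE)
    have "AE z in lborel. z \<noteq> 1" "AE z in lborel. z \<noteq> (-1::real)" by (rule AE_lborel_singleton)+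
    then show "AE z in lborel. cap \<kappa> z * cos (\<rho> * z) = indicator {-1..1} z *\<^sub>R f z"
    proof eventually_elim
      case (elim z) then show ?case
        by (auto simp: cap_def f_def indicator_def abs_le_iff abs_less_iff abs_eq_iff')
    qed
  qed (auto simp: f_def[abs_def])
  also have "\<dots> = integral {-1..1} f"
    by (intro set_borel_integral_eq_integral borel_integrable_atLeastAtMost' contf)
  also have "\<dots> = integral {sin (- (pi / 2))..sin (pi / 2)} f" by simp
  also have "\<dots> = integral {- (pi / 2)..pi / 2} (\<lambda>\<theta>. cos \<theta> *\<^sub>R f (sin \<theta>))"
  proof (rule integral_unique[symmetric], rule has_integral_substitution[where c="-1" and d=1])
    show "(sin has_real_derivative cos x) (at x within {- (pi / 2)..pi / 2})" for x
      by (auto intro!: derivative_eq_intros)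
  qed (use contf in auto)
  also have "\<dots> = integral {- (pi / 2)..pi / 2} (\<lambda>\<theta>. exp (\<kappa> * cos \<theta>) * cos (\<rho> * sin \<theta>) * cos \<theta>)"
  proof (rule integral_cong)
    fix \<theta> :: real assume "\<theta> \<in> {- (pi / 2)..pi / 2}"
    then have "0 \<le> cos \<theta>" by (intro cos_ge_zero) auto
    then have "sqrt (1 - (sin \<theta>)\<^sup>2) = cos \<theta>" by (simp flip: cos_squared_eq)
    then show "cos \<theta> *\<^sub>R f (sin \<theta>) = exp (\<kappa> * cos \<theta>) * cos (\<rho> * sin \<theta>) * cos \<theta>"
      by (simp add: f_def)
  qed
  finally show ?thesis .
qed

section \<open>The odd part as an integral over the full circle\<close>

lemma integral_shift_ivl:
  fixes f :: "real \<Rightarrow> real"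
  assumes "continuous_on UNIV f"
  shows "integral {a + c..b + c} f = integral {a..b} (\<lambda>x. f (x + c))"
proof -
  have "f integrable_on {a + c..b + c}"
    by (intro integrable_continuous_interval continuous_on_subset[OF assms]) auto
  then have "((f \<circ> (+) c) has_integral integral {a + c..b + c} f) (cbox a b)"
    unfolding has_integral_shift_cbox_iff by (simp add: has_integral_integral)
  then show ?thesis by (simp add: o_def add.commute integral_unique)
qed

lemma integral_period:
  fixes f :: "real \<Rightarrow> real"
  assumes cont: "continuous_on UNIV f" and per: "\<And>x. f (x + 2 * pi) = f x"
  shows "integral {0..2 * pi} f = integral {- (pi / 2)..pi / 2} (\<lambda>x. f x + f (x + pi))"
proof -
  have int: "f integrable_on {a..b}" for a b
    by (intro integrable_continuous_interval continuous_on_subset[OF cont]) auto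
  have cont': "continuous_on UNIV (\<lambda>x. f (x + pi))"
    by (intro continuous_on_compose2[OF cont] continuous_intros) auto
  have "integral {0..2 * pi} f = integral {0..3 * pi / 2} f + integral {3 * pi / 2..2 * pi} f"
    by (intro Henstock_Kurzweil_Integration.integral_combine[symmetric] int) auto
  also have "integral {3 * pi / 2..2 * pi} f = integral {- (pi / 2)..0} f"
    using integral_shift_ivl[OF cont, of "- (pi / 2)" "2 * pi" 0] by (simp add: per)
  also have "integral {0..3 * pi / 2} f + integral {- (pi / 2)..0} f = integral {- (pi / 2)..3 * pi / 2} f"
    by (subst add.commute) (intro Henstock_Kurzweil_Integration.integral_combine int; simp)
  also have "\<dots> = integral {- (pi / 2)..pi / 2} f + integral {pi / 2..3 * pi / 2} f"
    by (intro Henstock_Kurzweil_Integration.integral_combine[symmetric] int) auto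
  also have "integral {pi / 2..3 * pi / 2} f = integral {- (pi / 2)..pi / 2} (\<lambda>x. f (x + pi))"
    using integral_shift_ivl[OF cont, of "- (pi / 2)" pi "pi / 2"] by simp
  also have "integral {- (pi / 2)..pi / 2} f + \<dots> = integral {- (pi / 2)..pi / 2} (\<lambda>x. f x + f (x + pi))"
    by (intro integral_add[symmetric] int integrable_continuous_interval continuous_on_subset[OF cont']) auto
  finally show ?thesis .
qed

definition cap_odd :: "real \<Rightarrow> real \<Rightarrow> real" where
  "cap_odd \<beta> \<rho> = cap_cos \<beta> \<rho> - cap_cos (- \<beta>) \<rho>"

text \<open>On the opposite half circle \<open>cos\<close> and \<open>sin\<close> both change sign,
  so that half contributes \<open>- cap_cos (- \<beta>) \<rho>\<close>. The two halves together form
  a closed contour, which makes deformation possible.\<close>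

lemma cap_odd_eq_integral:
  "cap_odd \<beta> \<rho> = integral {0..2 * pi} (\<lambda>\<theta>. exp (\<beta> * cos \<theta>) * cos (\<rho> * sin \<theta>) * cos \<theta>)"
proof -
  have cont: "continuous_on S (\<lambda>\<theta>. exp (\<kappa> * cos \<theta>) * cos (\<rho> * sin \<theta>) * cos \<theta>)" for S \<kappa>
    by (intro continuous_intros)
  have "integral {0..2 * pi} (\<lambda>\<theta>. exp (\<beta> * cos \<theta>) * cos (\<rho> * sin \<theta>) * cos \<theta>) =
     integral {- (pi / 2)..pi / 2} (\<lambda>\<theta>. exp (\<beta> * cos \<theta>) * cos (\<rho> * sin \<theta>) * cos \<theta> -
        exp (- \<beta> * cos \<theta>) * cos (\<rho> * sin \<theta>) * cos \<theta>)"
    by (subst integral_period[OF cont]) simp_all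
  also have "\<dots> = cap_odd \<beta> \<rho>"
    unfolding cap_odd_def cap_cos_eq_integral
    by (intro integral_diff integrable_continuous_interval cont)
  finally show ?thesis by simp
qed

text \<open>Shifting \<open>\<theta>\<close> by an imaginary amount is a change of the radius of the circle.\<close>

lemma circle_radius_change:
  fixes a c :: real
  defines "W \<equiv> \<lambda>r. \<lambda>\<theta>. exp (of_real (a * r) * cis \<theta> + of_real (c / r) * cis (- \<theta>)) *
     (of_real r * cis \<theta> + cis (- \<theta>) / of_real r) / (2 :: complex)"
  assumes "r > 0"
  shows "integral {0..2 * pi} (W r) = integral {0..2 * pi} (W 1)"
proof -
  \<comment> \<open>On a circle about 0, \<open>dz / (\<i> * z)\<close> is \<open>d\<theta>\<close>,
    so this is the contour form of \<open>W\<close>. Its only singularity is 0, which lies inside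
    every such circle.\<close>
  define f where "f z = exp (of_real a * z + of_real c / z) * (z + 1 / z) / (2 * \<i> * z)" for z :: complex
  have holo: "f holomorphic_on UNIV - {0}"
    unfolding f_def by (intro holomorphic_intros) auto
  have *: "contour_integral (circlepath 0 e2) f = contour_integral (circlepath 0 e1) f"
    if "0 < e1" "e1 \<le> e2" for e1 e2
    by (rule contour_integral_circlepath_eq(3)[OF open_UNIV holo that]) auto
  have "contour_integral (circlepath 0 r) f = contour_integral (circlepath 0 1) f"
    using *[of r 1] *[of 1 r] \<open>r > 0\<close> by (metis linear zero_less_one)
  moreover have "contour_integral (circlepath 0 e) f = integral {0..2 * pi} (W e)" if "e > 0" for e
  proof -
    have "contour_integral (circlepath 0 e) f =
       integral {0..2 * pi} (\<lambda>\<theta>. f (0 + of_real e * cis \<theta>) * of_real e * \<i> * cis \<theta>)"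
      unfolding circlepath_def by (subst contour_integral_part_circlepath_eq) auto
    also have "\<dots> = integral {0..2 * pi} (W e)"
    proof (rule integral_cong)
      fix \<theta> :: real
      define z where "z = of_real e * cis \<theta>"
      have z: "z \<noteq> 0" using that by (simp add: z_def)
      have "1 / z = cis (- \<theta>) / of_real e"
        by (simp add: z_def divide_inverse flip: cis_inverse)
      moreover have "of_real a * z = of_real (a * e) * cis \<theta>" by (simp add: z_def)
      moreover have "of_real c / z = of_real c * (1 / z)" by simp
      ultimately have W: "W e \<theta> = exp (of_real a * z + of_real c / z) * (z + 1 / z) / 2"
        unfolding W_def by (simp add: z_def mult.assoc)
      have "f (0 + of_real e * cis \<theta>) * of_real e * \<i> * cis \<theta> = f z * (\<i> * z)"
        by (simp add: z_def mult_ac)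
      also have "\<dots> = exp (of_real a * z + of_real c / z) * (z + 1 / z) / 2"
        using z by (simp add: f_def)
      finally show "f (0 + of_real e * cis \<theta>) * of_real e * \<i> * cis \<theta> = W e \<theta>" unfolding W .
    qed
    finally show ?thesis .
  qed
  ultimately show ?thesis using \<open>r > 0\<close> by simp
qed

text \<open>The weights solve \<open>a + c = \<beta>\<close> and \<open>a - c = \<rho>\<close>, so
  on the unit circle \<open>a * z + c / z\<close> is
  \<open>\<beta> * cos \<theta> + \<i> * \<rho> * sin \<theta>\<close>. The radius stays free and is
  later chosen to balance the two terms of the exponent.\<close>

lemma cap_odd_eq_circle:
  fixes \<beta> \<rho> r :: real
  assumes "r > 0"
  defines "a \<equiv> (\<beta> + \<rho>) / 2" and "c \<equiv> (\<beta> - \<rho>) / 2"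
  shows "cap_odd \<beta> \<rho> = integral {0..2 * pi} (\<lambda>\<theta>. Re (exp (of_real (a * r) * cis \<theta> + of_real (c / r) * cis (- \<theta>)) *
     (of_real r * cis \<theta> + cis (- \<theta>) / of_real r) / 2))"
proof -
  define W where "W r \<theta> = exp (of_real (a * r) * cis \<theta> + of_real (c / r) * cis (- \<theta>)) *
     (of_real r * cis \<theta> + cis (- \<theta>) / of_real r) / (2 :: complex)" for r \<theta>
  have Re: "integral {0..2 * pi} (\<lambda>\<theta>. Re (W r \<theta>)) = Re (integral {0..2 * pi} (W r))" if "r > 0" for r
  proof -
    have "W r integrable_on {0..2 * pi}" unfolding W_def[abs_def] using that
      by (intro integrable_continuous_interval continuous_intros) auto
    from integral_linear[OF this bounded_linear_Re] show ?thesis by (simp add: o_def)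
  qed
  have "Re (W 1 \<theta>) = exp (\<beta> * cos \<theta>) * cos (\<rho> * sin \<theta>) * cos \<theta>" for \<theta>
  proof -
    have "of_real (a * 1) * cis \<theta> + of_real (c / 1) * cis (- \<theta>) = Complex (\<beta> * cos \<theta>) (\<rho> * sin \<theta>)"
      by (simp add: complex_eq_iff a_def c_def field_simps)
    moreover have "of_real 1 * cis \<theta> + cis (- \<theta>) / of_real 1 = of_real (2 * cos \<theta>)"
      by (simp add: complex_eq_iff)
    ultimately show ?thesis by (simp add: W_def Re_exp)
  qed
  then have "cap_odd \<beta> \<rho> = integral {0..2 * pi} (\<lambda>\<theta>. Re (W 1 \<theta>))"
    by (simp add: cap_odd_eq_integral)
  also have "\<dots> = integral {0..2 * pi} (\<lambda>\<theta>. Re (W r \<theta>))"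
    using Re[of 1] Re[OF assms(1)] circle_radius_change[OF assms(1), of a c] unfolding W_def by simp
  finally show ?thesis unfolding W_def .
qed

text \<open>Both weights are positive, so the radius \<open>sqrt (c / a)\<close> makes them equal to
  \<open>sqrt (a * c) = s / 2\<close>, and the exponent becomes the real number
  \<open>s * cos \<theta>\<close>.\<close>

lemma cap_odd_below:
  assumes "\<bar>\<rho>\<bar> < \<beta>"
  defines "s \<equiv> sqrt (\<beta>\<^sup>2 - \<rho>\<^sup>2)"
  shows "cap_odd \<beta> \<rho> = \<beta> * integral {0..2 * pi} (\<lambda>\<theta>. exp (s * cos \<theta>) * (sin \<theta>)\<^sup>2)"
proof -
  define a c where "a = (\<beta> + \<rho>) / 2" and "c = (\<beta> - \<rho>) / 2"
  have pos: "a > 0" "c > 0" "a + c = \<beta>" using assms by (auto simp: a_def c_def field_simps)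
  define r where "r = sqrt (c / a)"
  have r: "r > 0" using pos by (simp add: r_def)
  have s2: "s = 2 * sqrt (a * c)"
  proof -
    have "\<beta>\<^sup>2 - \<rho>\<^sup>2 = 2\<^sup>2 * (a * c)" by (simp add: a_def c_def power2_eq_square algebra_simps)
    then show ?thesis unfolding s_def by (simp only: real_sqrt_mult real_sqrt_abs)
  qed
  have spos: "s > 0" using s2 pos by simp
  have ar: "a * r = s / 2" "c / r = s / 2"
    using pos by (simp_all add: s2 r_def real_sqrt_divide real_sqrt_mult field_simps)
  have rr: "(r + 1 / r) / 2 = \<beta> / s"
    using pos by (simp add: s2 r_def real_sqrt_divide real_sqrt_mult field_simps)
  have "Re (exp (of_real (a * r) * cis \<theta> + of_real (c / r) * cis (- \<theta>)) *
     (of_real r * cis \<theta> + cis (- \<theta>) / of_real r) / 2) = \<beta> / s * (exp (s * cos \<theta>) * cos \<theta>)" for \<theta>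
  proof -
    have "of_real (a * r) * cis \<theta> + of_real (c / r) * cis (- \<theta>) = of_real (s * cos \<theta>)"
      unfolding ar by (simp add: complex_eq_iff)
    moreover have "Re ((of_real r * cis \<theta> + cis (- \<theta>) / of_real r) / 2) = \<beta> / s * cos \<theta>"
      unfolding rr[symmetric] by (simp add: algebra_simps add_divide_distrib)
    moreover have "Re (of_real x * y) = x * Re y" for x y by simp
    ultimately show ?thesis
      by (simp only: times_divide_eq_right[symmetric] exp_of_real) simp
  qed
  then have "cap_odd \<beta> \<rho> = integral {0..2 * pi} (\<lambda>\<theta>. \<beta> / s * (exp (s * cos \<theta>) * cos \<theta>))"
    using cap_odd_eq_circle[OF r, of \<beta> \<rho>] unfolding a_def c_def by simp
  also have "\<dots> = \<beta> / s * integral {0..2 * pi} (\<lambda>\<theta>. exp (s * cos \<theta>) * cos \<theta>)" by simp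
  \<comment> \<open>Integration by parts with the primitive
    \<open>exp (s * cos \<theta>) * sin \<theta>\<close>. The integrand becomes nonnegative and the
    factor \<open>1 / s\<close> in front disappears.\<close>
  also have "integral {0..2 * pi} (\<lambda>\<theta>. exp (s * cos \<theta>) * cos \<theta>) =
      s * integral {0..2 * pi} (\<lambda>\<theta>. exp (s * cos \<theta>) * (sin \<theta>)\<^sup>2)"
  proof -
    have "((\<lambda>\<theta>. exp (s * cos \<theta>) * cos \<theta> - s * (exp (s * cos \<theta>) * (sin \<theta>)\<^sup>2)) has_integral
        (exp (s * cos (2 * pi)) * sin (2 * pi) - exp (s * cos 0) * sin 0)) {0..2 * pi}"
      by (intro fundamental_theorem_of_calculus)
         (auto simp: has_real_derivative_iff_has_vector_derivative[symmetric] power2_eq_square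
           intro!: derivative_eq_intros)
    then have "integral {0..2 * pi} (\<lambda>\<theta>. exp (s * cos \<theta>) * cos \<theta> - s * (exp (s * cos \<theta>) * (sin \<theta>)\<^sup>2)) = 0"
      by (simp add: integral_unique)
    also have "integral {0..2 * pi} (\<lambda>\<theta>. exp (s * cos \<theta>) * cos \<theta> - s * (exp (s * cos \<theta>) * (sin \<theta>)\<^sup>2)) =
       integral {0..2 * pi} (\<lambda>\<theta>. exp (s * cos \<theta>) * cos \<theta>) -
       integral {0..2 * pi} (\<lambda>\<theta>. s * (exp (s * cos \<theta>) * (sin \<theta>)\<^sup>2))"
      by (intro integral_diff integrable_continuous_interval continuous_intros)
    finally show ?thesis by simp
  qed
  finally show ?thesis using spos by simp
qed

text \<open>Past the cutoff the second weight is negative, so balancing the moduli makes the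
  exponent purely imaginary, \<open>\<i> * t * sin \<theta>\<close>. The part with
  \<open>cos (t * sin \<theta>) * cos \<theta>\<close> is an exact derivative and integrates to 0;
  the remaining integral is \<open>2 * pi * J_1 t\<close>.\<close>

lemma cap_odd_above:
  assumes "\<beta> > 0" "\<rho> > \<beta>"
  defines "t \<equiv> sqrt (\<rho>\<^sup>2 - \<beta>\<^sup>2)"
  shows "cap_odd \<beta> \<rho> = \<beta> / t * integral {0..2 * pi} (\<lambda>\<theta>. sin (t * sin \<theta>) * sin \<theta>)"
proof -
  define a c where "a = (\<rho> + \<beta>) / 2" and "c = (\<rho> - \<beta>) / 2"
  have pos: "a > 0" "c > 0" "a - c = \<beta>" using assms by (auto simp: a_def c_def field_simps)
  define r where "r = sqrt (c / a)"
  have r: "r > 0" using pos by (simp add: r_def)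
  have t2: "t = 2 * sqrt (a * c)"
  proof -
    have "\<rho>\<^sup>2 - \<beta>\<^sup>2 = 2\<^sup>2 * (a * c)" by (simp add: a_def c_def power2_eq_square algebra_simps)
    then show ?thesis unfolding t_def by (simp only: real_sqrt_mult real_sqrt_abs)
  qed
  have tpos: "t > 0" using t2 pos by simp
  define A C where "A = sqrt a" and "C = sqrt c"
  have AC: "A > 0" "C > 0" "a = A * A" "c = C * C" "r = C / A" "t = 2 * (A * C)"
    using pos by (simp_all add: A_def C_def r_def t2 real_sqrt_divide real_sqrt_mult)
  have ar: "a * r = t / 2" "- c / r = - (t / 2)" and rr: "(1 / r - r) / 2 = \<beta> / t"
    using AC(1,2) pos(3)[symmetric] unfolding AC(3-6) by (simp_all add: field_simps)
  have "Re (exp (of_real (a * r) * cis \<theta> + of_real (- c / r) * cis (- \<theta>)) *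
     (of_real r * cis \<theta> + cis (- \<theta>) / of_real r) / 2) =
      (r + 1 / r) / 2 * (cos (t * sin \<theta>) * cos \<theta>) + \<beta> / t * (sin (t * sin \<theta>) * sin \<theta>)" for \<theta>
  proof -
    have "of_real (a * r) * cis \<theta> + of_real (- c / r) * cis (- \<theta>) = \<i> * of_real (t * sin \<theta>)"
      unfolding ar by (simp add: complex_eq_iff)
    then have "exp (of_real (a * r) * cis \<theta> + of_real (- c / r) * cis (- \<theta>)) = cis (t * sin \<theta>)"
      by (simp add: cis_conv_exp)
    then show ?thesis unfolding rr[symmetric]
      by (simp add: add_divide_distrib diff_divide_distrib algebra_simps)
  qed
  moreover have "(\<beta> + \<rho>) / 2 = a" "(\<beta> - \<rho>) / 2 = - c" by (simp_all add: a_def c_def field_simps)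
  ultimately have "cap_odd \<beta> \<rho> = integral {0..2 * pi} (\<lambda>\<theta>. (r + 1 / r) / 2 * (cos (t * sin \<theta>) * cos \<theta>) +
      \<beta> / t * (sin (t * sin \<theta>) * sin \<theta>))"
    by (simp only: cap_odd_eq_circle[OF r, of \<beta> \<rho>])
  also have "\<dots> = integral {0..2 * pi} (\<lambda>\<theta>. (r + 1 / r) / 2 * (cos (t * sin \<theta>) * cos \<theta>)) +
      integral {0..2 * pi} (\<lambda>\<theta>. \<beta> / t * (sin (t * sin \<theta>) * sin \<theta>))"
    by (intro integral_add integrable_continuous_interval continuous_intros) (use r in auto)
  also have "\<dots> = (r + 1 / r) / 2 * integral {0..2 * pi} (\<lambda>\<theta>. cos (t * sin \<theta>) * cos \<theta>) +
      \<beta> / t * integral {0..2 * pi} (\<lambda>\<theta>. sin (t * sin \<theta>) * sin \<theta>)"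
    by (simp only: integral_mult_right)
  also have "integral {0..2 * pi} (\<lambda>\<theta>. cos (t * sin \<theta>) * cos \<theta>) = 0"
  proof -
    have "((\<lambda>\<theta>. cos (t * sin \<theta>) * cos \<theta>) has_integral
        (sin (t * sin (2 * pi)) / t - sin (t * sin 0) / t)) {0..2 * pi}"
      using tpos by (intro fundamental_theorem_of_calculus)
         (auto simp: has_real_derivative_iff_has_vector_derivative[symmetric] field_simps
           intro!: derivative_eq_intros)
    then show ?thesis by (simp add: integral_unique)
  qed
  finally show ?thesis by simp
qed

text \<open>The phase \<open>t * sin \<theta>\<close> is stationary at \<open>\<theta> = \<plusminus> \<pi> / 2\<close>; a neighbourhood of radius
  \<open>1 / sqrt t\<close> is estimated trivially and the rest is integrated by parts.\<close>

lemma oscillatory_integral_bound: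
  assumes "t > 0"
  shows "\<bar>integral {0..2 * pi} (\<lambda>\<theta>. sin (t * sin \<theta>) * sin \<theta>)\<bar> \<le> 20 / sqrt t"
proof (cases "t \<ge> 1")
  case False
  have "norm (integral {0..2 * pi} (\<lambda>\<theta>. sin (t * sin \<theta>) * sin \<theta>)) \<le> integral {0..2 * pi} (\<lambda>\<theta>. 1)"
    by (intro integral_norm_bound_integral integrable_continuous_interval continuous_intros)
       (auto simp: abs_mult intro!: mult_le_one)
  also have "\<dots> \<le> 20 / 1" using pi_less_4 by simp
  also have "\<dots> \<le> 20 / sqrt t" using assms False by (intro divide_left_mono) auto
  finally show ?thesis by simp
next
  case True
  \<comment> \<open>This radius balances the excluded pieces, of length \<open>d\<close>, against
    boundary terms of order \<open>1 / (t * d)\<close>, which also equals \<open>d\<close>.\<close>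
  define d where "d = 1 / sqrt t"
  define g where "g \<theta> = sin (t * sin \<theta>) * sin \<theta>" for \<theta>
  have d: "0 < d" "d \<le> 1" "1 / (t * d) = d"
    using True by (simp_all add: d_def real_div_sqrt)
  have dpi: "d < pi / 2" using d pi_gt3 by linarith
  define m where "m = pi / 2 - d"
  have m: "0 < m" "m < pi / 2" using dpi d by (auto simp: m_def)
  have cpos: "cos x > 0" if "x \<in> {-m..m}" for x
    using that m by (intro cos_gt_zero_pi) auto
  have cont: "continuous_on S g" for S unfolding g_def by (intro continuous_intros)
  have intg: "g integrable_on {a..b}" for a b
    by (intro integrable_continuous_interval cont)
  have gle: "norm (g x) \<le> 1" for x by (auto simp: g_def abs_mult intro!: mult_le_one)
  have tanm: "tan m \<le> 2 / d"
  proof -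
    have "d / 2 \<le> sin d" using d dpi by (intro half_le_sin) auto
    moreover have "tan m = cos d / sin d" by (simp add: m_def tan_def sin_diff cos_diff)
    ultimately show ?thesis using d frac_le[of 1 "cos d" "d / 2" "sin d"] by simp
  qed
  have mid: "\<bar>integral {-m..m} g\<bar> \<le> 8 * d"
  proof -
    \<comment> \<open>The derivative of \<open>cos (t * sin \<theta>)\<close> is
      \<open>- t * cos \<theta> * sin (t * sin \<theta>)\<close>, so integrating \<open>g\<close> by
      parts puts \<open>tan \<theta> / t\<close> on the boundary and leaves \<open>h\<close>,
      dominated by the derivative of \<open>tan \<theta> / t\<close>. Boundary and remainder cost at
      most \<open>2 * tan m / t\<close> each.\<close>
    define h where "h \<theta> = cos (t * sin \<theta>) / (t * (cos \<theta>)\<^sup>2)" for \<theta>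
    have h: "h integrable_on {-m..m}"
      unfolding h_def using cpos \<open>t > 0\<close>
      by (intro integrable_continuous_interval continuous_intros) force+
    have "((\<lambda>\<theta>. g \<theta> - h \<theta>) has_integral
        (- tan m * cos (t * sin m) / t - (- tan (- m) * cos (t * sin (- m)) / t))) {-m..m}"
    proof (intro fundamental_theorem_of_calculus)
      fix x assume x: "x \<in> {-m..m}"
      note c = cpos[OF x]
      show "((\<lambda>\<theta>. - tan \<theta> * cos (t * sin \<theta>) / t) has_vector_derivative g x - h x) (at x within {-m..m})"
        unfolding has_real_derivative_iff_has_vector_derivative[symmetric]
        using c assms by (auto intro!: derivative_eq_intros simp: g_def h_def tan_def field_simps power2_eq_square)
          (use sin_cos_squared_add3[of x] in algebra)
    qed (use m in auto)
    then have "integral {-m..m} (\<lambda>\<theta>. g \<theta> - h \<theta>) = - 2 * (tan m / t * cos (t * sin m))"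
      by (simp add: integral_unique)
    then have "integral {-m..m} g - integral {-m..m} h = - 2 * (tan m / t * cos (t * sin m))"
      using integral_diff[OF intg h] by simp
    moreover have "\<bar>tan m / t * cos (t * sin m)\<bar> \<le> tan m / t"
    proof -
      have "0 \<le> tan m" using m tan_gt_zero[of m] by simp
      then have "0 \<le> tan m / t" using assms by simp
      then show ?thesis using mult_left_mono[OF abs_cos_le_one[of "t * sin m"], of "tan m / t"]
        by (simp only: abs_mult abs_of_nonneg mult_1_right)
    qed
    moreover have "\<bar>integral {-m..m} h\<bar> \<le> 2 * (tan m / t)"
    proof -
      have I: "((\<lambda>\<theta>. 1 / (t * (cos \<theta>)\<^sup>2)) has_integral (tan m / t - tan (- m) / t)) {-m..m}"
      proof (intro fundamental_theorem_of_calculus)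
        fix x assume x: "x \<in> {-m..m}"
        note c = cpos[OF x]
        show "((\<lambda>\<theta>. tan \<theta> / t) has_vector_derivative 1 / (t * (cos x)\<^sup>2)) (at x within {-m..m})"
          unfolding has_real_derivative_iff_has_vector_derivative[symmetric]
          using c assms by (auto intro!: derivative_eq_intros simp: divide_inverse)
      qed (use m in auto)
      have "norm (integral {-m..m} h) \<le> integral {-m..m} (\<lambda>\<theta>. 1 / (t * (cos \<theta>)\<^sup>2))"
        using assms I
        by (intro integral_norm_bound_integral h)
           (auto simp: h_def abs_mult intro!: divide_right_mono)
      then show ?thesis using integral_unique[OF I] by simp
    qed
    ultimately have "\<bar>integral {-m..m} g\<bar> \<le> 4 * (tan m / t)" by linarith
    also have "tan m / t \<le> 2 / d / t" using tanm assms by (intro divide_right_mono) auto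
    also have "2 / d / t = 2 * d" using d(3) by (simp add: field_simps)
    finally show ?thesis by simp
  qed
  have small: "\<bar>integral {a..b} g\<bar> \<le> b - a" if "a \<le> b" for a b
  proof -
    have "norm (integral {a..b} g) \<le> integral {a..b} (\<lambda>\<theta>. 1)"
      by (intro integral_norm_bound_integral intg) (use gle in auto)
    then show ?thesis using that by simp
  qed
  \<comment> \<open>Invariance of \<open>g\<close> under the shift by \<open>pi\<close> folds the
    circle onto one half with a stationary point at each end. End pieces and middle give
    \<open>2 * (d + 8 * d + d)\<close>, the origin of the 20.\<close>
  have "integral {0..2 * pi} g = integral {- (pi / 2)..pi / 2} (\<lambda>x. g x + g (x + pi))"
    by (rule integral_period[OF cont]) (simp add: g_def)
  also have "(\<lambda>x. g x + g (x + pi)) = (\<lambda>x. 2 * g x)"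
    by (simp add: g_def fun_eq_iff)
  also have "integral {- (pi / 2)..pi / 2} \<dots> = 2 * integral {- (pi / 2)..pi / 2} g"
    by simp
  also have "integral {- (pi / 2)..pi / 2} g =
      integral {- (pi / 2)..- m} g + integral {- m..m} g + integral {m..pi / 2} g"
    using m by (simp add: Henstock_Kurzweil_Integration.integral_combine intg)
  finally have "\<bar>integral {0..2 * pi} g\<bar> \<le> 2 * (d + 8 * d + d)"
    using small[of "- (pi / 2)" "- m"] small[of m "pi / 2"] mid m by (simp add: m_def)
  then show ?thesis by (simp add: d_def g_def[abs_def])
qed

text \<open>This is \<open>2 * pi * I_1 s / s\<close>, in a form that has a nonnegative integrand
  and no singularity at \<open>s = 0\<close>, where the value is \<open>pi\<close>.\<close>

definition bessel_int :: "real \<Rightarrow> real" where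
  "bessel_int s = integral {0..2 * pi} (\<lambda>\<theta>. exp (s * cos \<theta>) * (sin \<theta>)\<^sup>2)"

text \<open>The exponential dominates \<open>1 + s * cos \<theta>\<close>, whose linear term
  integrates to 0 against \<open>(sin \<theta>)\<^sup>2\<close>. A bound free of \<open>s\<close>
  serves where exponential growth is not yet available: at the cutoff and for narrow
  kernels.\<close>

lemma bessel_int_ge_pi: "pi \<le> bessel_int s"
proof -
  have I: "((\<lambda>\<theta>. (1 + s * cos \<theta>) * (sin \<theta>)\<^sup>2) has_integral
     ((2 * pi) / 2 - sin (2 * pi) * cos (2 * pi) / 2 + s * sin (2 * pi) ^ 3 / 3 -
      (0 / 2 - sin 0 * cos 0 / 2 + s * sin 0 ^ 3 / 3))) {0..2 * pi}"
  proof (intro fundamental_theorem_of_calculus)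
    fix x :: real
    have "1 / 2 - (cos x * cos x - sin x * sin x) / 2 = (sin x)\<^sup>2"
      using sin_cos_squared_add[of x] by (simp add: power2_eq_square field_simps)
    then show "((\<lambda>\<theta>. \<theta> / 2 - sin \<theta> * cos \<theta> / 2 + s * sin \<theta> ^ 3 / 3) has_vector_derivative
        (1 + s * cos x) * (sin x)\<^sup>2) (at x within {0..2 * pi})"
      unfolding has_real_derivative_iff_has_vector_derivative[symmetric]
      by (auto intro!: derivative_eq_intros simp: field_simps power2_eq_square)
         (use sin_cos_squared_add3[of x] in algebra)
  qed simp
  have "pi = integral {0..2 * pi} (\<lambda>\<theta>. (1 + s * cos \<theta>) * (sin \<theta>)\<^sup>2)"
    using integral_unique[OF I] by simp
  also have "\<dots> \<le> bessel_int s"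
    unfolding bessel_int_def
    by (intro integral_le integrable_continuous_interval continuous_intros mult_right_mono exp_ge_add_one_self) auto
  finally show ?thesis .
qed

text \<open>Laplace's method on \<open>[d / 2, d]\<close> alone: there
  \<open>s * cos \<theta>\<close> falls short of \<open>s\<close> by at most
  \<open>s * d\<^sup>2 / 2 \<le> 1 / 2\<close>, and \<open>sin \<theta> \<ge> d / 4\<close>. The
  length \<open>d / 2\<close>, the factor 1/2 for \<open>exp (- (1 / 2))\<close> and
  \<open>(d / 4)\<^sup>2\<close> multiply to \<open>d ^ 3 / 64\<close>. Taking \<open>1 + s\<close>
  keeps \<open>d \<le> 1\<close> down to \<open>s = 0\<close>.\<close>

lemma bessel_int_ge_exp:
  assumes "s \<ge> 0"
  shows "exp s / (64 * ((1 + s) * sqrt (1 + s))) \<le> bessel_int s"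
proof -
  define d where "d = 1 / sqrt (1 + s)"
  have d: "0 < d" "d \<le> 1" "d\<^sup>2 = 1 / (1 + s)" using assms by (auto simp: d_def power_divide)
  have dpi: "d < pi / 2" using d pi_gt3 by linarith
  have cont: "continuous_on S (\<lambda>\<theta>. exp (s * cos \<theta>) * (sin \<theta>)\<^sup>2)" for S by (intro continuous_intros)
  have "exp s / (64 * ((1 + s) * sqrt (1 + s))) = d / 2 * (exp s / 2 * (d / 4)\<^sup>2)"
  proof -
    have "d / 2 * (exp s / 2 * (d / 4)\<^sup>2) = exp s * (d * d\<^sup>2) / 64" by (simp add: power2_eq_square)
    also have "\<dots> = exp s / (64 * ((1 + s) * sqrt (1 + s)))"
      unfolding d(3) by (simp add: d_def)
    finally show ?thesis by simp
  qed
  also have "\<dots> = integral {d / 2..d} (\<lambda>\<theta>. exp s / 2 * (d / 4)\<^sup>2)" using d by simp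
  also have "\<dots> \<le> integral {d / 2..d} (\<lambda>\<theta>. exp (s * cos \<theta>) * (sin \<theta>)\<^sup>2)"
  proof (intro integral_le integrable_continuous_interval cont mult_mono)
    fix x assume x: "x \<in> {d / 2..d}"
    have "x / 2 \<le> sin x" using x d dpi by (intro half_le_sin) auto
    then show "(d / 4)\<^sup>2 \<le> (sin x)\<^sup>2" using x d by (intro power_mono) auto
    have "(sin (x / 2))\<^sup>2 \<le> (x / 2)\<^sup>2"
      using abs_sin_x_le_abs_x[of "x / 2"] by (simp only: abs_le_square_iff)
    then have "1 - x\<^sup>2 / 2 \<le> cos x" using cos_double_sin[of "x / 2"] by (simp add: power_divide)
    moreover have "x\<^sup>2 \<le> d\<^sup>2" using x d by (intro power_mono) auto
    ultimately have "1 - d\<^sup>2 / 2 \<le> cos x" by linarith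
    then have "s * (1 - d\<^sup>2 / 2) \<le> s * cos x" using assms by (rule mult_left_mono)
    moreover have "s * d\<^sup>2 \<le> 1" unfolding d(3) using assms by simp
    ultimately have "s + - (1 / 2) \<le> s * cos x" by (simp add: algebra_simps)
    then have "exp (s + - (1 / 2)) \<le> exp (s * cos x)" by simp
    moreover have "1 / 2 \<le> exp (- (1 / 2) :: real)" using exp_ge_add_one_self[of "- (1 / 2)"] by simp
    then have "exp s * (1 / 2) \<le> exp s * exp (- (1 / 2))" by (intro mult_left_mono) auto
    ultimately show "exp s / 2 \<le> exp (s * cos x)" unfolding exp_add[of s "- (1 / 2)"] by linarith
  qed auto
  also have "\<dots> \<le> bessel_int s"
    unfolding bessel_int_def using d dpi
    by (intro integral_subset_le integrable_continuous_interval cont) auto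
  finally show ?thesis .
qed

section \<open>Bounds on the odd part on both sides of the cutoff\<close>

lemma cap_cos_abs: "cap_cos \<kappa> \<bar>\<rho>\<bar> = cap_cos \<kappa> \<rho>"
  unfolding cap_cos_def by (simp add: abs_if)


lemma continuous_cap_cos: "continuous_on UNIV (cap_cos \<kappa>)"
proof -
  have "continuous_on UNIV (\<lambda>\<rho>. integral (cbox (- (pi / 2)) (pi / 2))
      (\<lambda>\<theta>. exp (\<kappa> * cos \<theta>) * cos (\<rho> * sin \<theta>) * cos \<theta>))"
    by (intro integral_continuous_on_param) (auto simp: split_beta intro!: continuous_intros)
  then show ?thesis by (simp add: cap_cos_eq_integral[abs_def])
qed

text \<open>At \<open>\<bar>\<rho>\<bar> = \<beta>\<close> one of the weights \<open>a\<close>,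
  \<open>c\<close> is 0 and the balancing radius degenerates, so \<open>cap_odd_below\<close> does
  not apply; continuity of the transform carries the bound to the cutoff from the left.\<close>

lemma cap_odd_ge_pi:
  assumes "0 < \<beta>" "\<bar>\<rho>\<bar> \<le> \<beta>"
  shows "\<beta> * pi \<le> cap_odd \<beta> \<rho>"
proof -
  have below: "\<beta> * pi \<le> cap_odd \<beta> r" if "\<bar>r\<bar> < \<beta>" for r
    using cap_odd_below[OF that] bessel_int_ge_pi assms unfolding bessel_int_def
    by (simp add: mult_left_mono)
  show ?thesis
  proof (cases "\<bar>\<rho>\<bar> < \<beta>")
    case False
    then have eq: "\<bar>\<rho>\<bar> = \<beta>" using assms by simp
    have "continuous_on UNIV (cap_odd \<beta>)"
      unfolding cap_odd_def[abs_def] by (intro continuous_intros continuous_cap_cos)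
    then have "(cap_odd \<beta> \<longlongrightarrow> cap_odd \<beta> \<beta>) (at_left \<beta>)"
      by (simp add: continuous_on_def filterlim_at_split)
    moreover have "\<forall>\<^sub>F r in at_left \<beta>. \<beta> * pi \<le> cap_odd \<beta> r"
      using eventually_at_left_real[of 0 \<beta>] assms(1)
      by (auto elim!: eventually_mono intro!: below)
    ultimately have "\<beta> * pi \<le> cap_odd \<beta> \<beta>"
      by (rule tendsto_lowerbound) simp
    then show ?thesis unfolding eq[symmetric] cap_odd_def cap_cos_abs by simp
  qed (rule below)
qed

lemma cap_odd_ge_exp:
  assumes "0 < \<beta>" "\<bar>\<rho>\<bar> \<le> \<beta>"
  defines "s \<equiv> sqrt (\<beta>\<^sup>2 - \<rho>\<^sup>2)"
  shows "\<beta> * (exp s / (64 * ((1 + s) * sqrt (1 + s)))) \<le> cap_odd \<beta> \<rho>"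
proof (cases "\<bar>\<rho>\<bar> < \<beta>")
  case True
  then have "\<rho>\<^sup>2 \<le> \<beta>\<^sup>2" using abs_le_square_iff[of \<rho> \<beta>] by simp
  then have "0 \<le> s" by (simp add: s_def)
  then have "\<beta> * (exp s / (64 * ((1 + s) * sqrt (1 + s)))) \<le> \<beta> * bessel_int s"
    using assms(1) by (intro mult_left_mono bessel_int_ge_exp) auto
  also have "\<dots> = cap_odd \<beta> \<rho>"
    using cap_odd_below[OF True] unfolding bessel_int_def s_def by simp
  finally show ?thesis .
next
  case False
  then have "\<bar>\<rho>\<bar> = \<beta>" using assms by simp
  \<comment> \<open>At the cutoff the claim is only \<open>\<beta> / 64\<close>, which the bound by
    \<open>\<beta> * pi\<close> covers.\<close>
  then have "s = 0" unfolding s_def using power2_abs[of \<rho>] by simp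
  then have "\<beta> * (exp s / (64 * ((1 + s) * sqrt (1 + s)))) = \<beta> * (1 / 64)" by simp
  also have "\<dots> \<le> \<beta> * pi" using assms(1) pi_gt3 by (intro mult_left_mono) auto
  finally show ?thesis using cap_odd_ge_pi[OF assms(1,2)] by linarith
qed

text \<open>The prefactor \<open>\<beta> / t\<close> and the stationary-phase decay
  \<open>1 / sqrt t\<close> combine to an exponent below \<open>-1\<close>, which makes the alias
  sum of the odd part absolutely convergent.\<close>

lemma abs_cap_odd_le:
  assumes "0 < \<beta>" "\<beta> < \<bar>\<rho>\<bar>"
  defines "t \<equiv> sqrt (\<rho>\<^sup>2 - \<beta>\<^sup>2)"
  shows "\<bar>cap_odd \<beta> \<rho>\<bar> \<le> 20 * \<beta> * t powr (-3/2)"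
proof -
  have "\<beta>\<^sup>2 < \<rho>\<^sup>2" using power_strict_mono[OF assms(2), of 2] assms(1) by simp
  then have t: "t > 0" by (simp add: t_def)
  have "cap_odd \<beta> \<rho> = cap_odd \<beta> \<bar>\<rho>\<bar>" by (simp add: cap_odd_def cap_cos_abs)
  also have "\<dots> = \<beta> / t * integral {0..2 * pi} (\<lambda>\<theta>. sin (t * sin \<theta>) * sin \<theta>)"
    using cap_odd_above[OF assms(1,2)] by (simp add: t_def)
  finally have "\<bar>cap_odd \<beta> \<rho>\<bar> = \<beta> / t * \<bar>integral {0..2 * pi} (\<lambda>\<theta>. sin (t * sin \<theta>) * sin \<theta>)\<bar>"
    using t assms(1) by (simp add: abs_mult)
  also have "\<dots> \<le> \<beta> / t * (20 / sqrt t)"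
    using t assms(1) by (intro mult_left_mono oscillatory_integral_bound) auto
  also have "\<dots> = 20 * \<beta> * (1 / (t * sqrt t))" by simp
  also have "1 / (t * sqrt t) = t powr (-3/2)"
  proof -
    have "t powr (3/2) = t powr (1 + 1/2)" by simp
    also have "\<dots> = t * sqrt t" using t by (simp only: powr_add powr_half_sqrt powr_one less_imp_le)
    finally show ?thesis using powr_minus_divide[of t "3/2"] by simp
  qed
  finally show ?thesis .
qed

text \<open>Nonvanishing is wanted for every width, hence also for small \<open>\<beta>\<close>. If
  \<open>\<beta> \<le> 1\<close>, the phase stays in \<open>[-1, 1]\<close>, where
  \<open>cos\<close> is positive, and the remainder only helps; if \<open>\<beta> > 1\<close>, the
  odd part exceeds \<open>pi\<close> while the remainder is at most 2 in modulus.\<close>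

lemma cap_cos_pos:
  assumes "0 < \<beta>" "\<bar>\<rho>\<bar> \<le> \<beta>"
  shows "0 < cap_cos \<beta> \<rho>"
proof (cases "\<beta> \<le> 1")
  case True
  have "0 \<le> cap_cos (- \<beta>) \<rho>"
    unfolding cap_cos_def
  proof (rule Bochner_Integration.integral_nonneg)
    fix z :: real
    show "0 \<le> cap (- \<beta>) z * cos (\<rho> * z)"
    proof (cases "\<bar>z\<bar> \<le> 1")
      case z: True
      have "\<bar>\<rho> * z\<bar> \<le> 1 * 1" unfolding abs_mult using z True assms(2) by (intro mult_mono) auto
      then have "0 \<le> cos (\<rho> * z)" using pi_gt3 by (intro cos_ge_zero) auto
      then show ?thesis by (simp add: cap_nonneg)
    qed (simp add: cap_eq_0)
  qed
  moreover have "0 < \<beta> * pi" using assms(1) by simp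
  ultimately show ?thesis using cap_odd_ge_pi[OF assms] unfolding cap_odd_def by linarith
next
  case False
  then have "1 * pi < \<beta> * pi" by (intro mult_strict_right_mono) auto
  then show ?thesis
    using cap_odd_ge_pi[OF assms] abs_cap_cos_le[of "- \<beta>" \<rho>] assms(1) pi_gt3
    unfolding cap_odd_def by linarith
qed

section \<open>Alias sums\<close>

lemma psi_hat_alias_eq:
  assumes "n \<ge> 1" "w \<ge> 1"
  shows "psi_hat n w \<beta> (k + m * int n) =
     of_real (pi * real w / real n * exp (- \<beta>) * cap_cos \<beta> (pi * real w * (of_int m + of_int k / real n)))"
proof -
  have "pi * real w * real_of_int (k + m * int n) / real n = pi * real w * (of_int m + of_int k / real n)"
    using assms by (simp add: field_simps)
  then show ?thesis unfolding fourier_psi[OF assms] fourier_cap by simp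
qed

lemma psi_hat_eq:
  assumes "n \<ge> 1" "w \<ge> 1"
  shows "psi_hat n w \<beta> k = of_real (pi * real w / real n * exp (- \<beta>) * cap_cos \<beta> (pi * real w * (of_int k / real n)))"
  using psi_hat_alias_eq[OF assms, of \<beta> k 0] by simp

lemma psi_hat_poisson:
  assumes n: "n \<ge> 1" and w: "w \<ge> 1"
  shows "(\<lambda>M. \<Sum>m=-int M..int M. psi_hat n w \<beta> (k + m * int n) * cis (of_int (k + m * int n) * x))
    \<longlonglongrightarrow> 2 * pi / of_nat n *
      (\<Sum>\<^sub>\<infinity>l::int. complex_of_real (psi n w \<beta> (2 * pi * of_int l / real n - x)) *
           cis (2 * pi * of_int l * of_int k / real n))"
proof -
  define A where "A = complex_of_real (pi * real w / real n * exp (- \<beta>))"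
  have "(\<lambda>M. A * (\<Sum>m=-int M..int M. fourier (cap \<beta>) (pi * real w * (of_int m + of_int k / real n)) *
            cis (of_int (k + m * int n) * x)))
    \<longlonglongrightarrow> A * (2 / of_nat w *
          (\<Sum>\<^sub>\<infinity>l::int. complex_of_real (cap \<beta> ((2 * pi * of_int l - real n * x) / (pi * real w))) *
                      cis (of_int k / real n * (2 * pi * of_int l))))"
    by (intro tendsto_mult tendsto_const cap_poisson assms)
  moreover have "A * (fourier (cap \<beta>) (pi * real w * (of_int m + of_int k / real n)) * c) =
     psi_hat n w \<beta> (k + m * int n) * c" for m c
    unfolding psi_hat_alias_eq[OF assms] fourier_cap A_def by simp
  moreover have "A * (2 / of_nat w *
          (\<Sum>\<^sub>\<infinity>l::int. complex_of_real (cap \<beta> ((2 * pi * of_int l - real n * x) / (pi * real w))) *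
                      cis (of_int k / real n * (2 * pi * of_int l)))) =
       2 * pi / of_nat n *
      (\<Sum>\<^sub>\<infinity>l::int. complex_of_real (psi n w \<beta> (2 * pi * of_int l / real n - x)) *
           cis (2 * pi * of_int l * of_int k / real n))"
  proof -
    have "complex_of_real (psi n w \<beta> (2 * pi * of_int l / real n - x)) * cis (2 * pi * of_int l * of_int k / real n) =
      of_real (exp (- \<beta>)) * (complex_of_real (cap \<beta> ((2 * pi * of_int l - real n * x) / (pi * real w))) *
                      cis (of_int k / real n * (2 * pi * of_int l)))" for l :: int
    proof -
      have "real n * (2 * pi * of_int l / real n - x) = 2 * pi * of_int l - real n * x"
        using n by (simp add: field_simps)
      moreover have "2 * pi * of_int l * of_int k / real n = of_int k / real n * (2 * pi * of_int l)" by simp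
      ultimately show ?thesis unfolding psi_eq_cap[OF assms] by (simp add: mult_ac)
    qed
    then show ?thesis using w by (simp add: A_def infsum_cmult_right')
  qed
  ultimately show ?thesis by (simp only: sum_distrib_left)
qed

lemma alias_partial_eq:
  "alias_partial n w \<beta> k x M =
     (\<Sum>m=-int M..int M. psi_hat n w \<beta> (k + m * int n) * cis (of_int (k + m * int n) * x)) -
     psi_hat n w \<beta> k * cis (of_int k * x)"
  unfolding alias_partial_def by (subst sum_diff1) auto

lemma alias_partial_tendsto:
  assumes n: "n \<ge> 1" and w: "w \<ge> 1"
  shows "alias_partial n w \<beta> k x \<longlonglongrightarrow> 2 * pi / of_nat n *
      (\<Sum>\<^sub>\<infinity>l::int. complex_of_real (psi n w \<beta> (2 * pi * of_int l / real n - x)) *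
           cis (2 * pi * of_int l * of_int k / real n)) - psi_hat n w \<beta> k * cis (of_int k * x)"
  unfolding alias_partial_eq[abs_def] by (intro tendsto_diff tendsto_const psi_hat_poisson assms)

lemma alias_sum_eq:
  assumes n: "n \<ge> 1" and w: "w \<ge> 1"
  shows "alias_sum n w \<beta> k x = 2 * pi / of_nat n *
      (\<Sum>\<^sub>\<infinity>l::int. complex_of_real (psi n w \<beta> (2 * pi * of_int l / real n - x)) *
           cis (2 * pi * of_int l * of_int k / real n)) - psi_hat n w \<beta> k * cis (of_int k * x)"
  unfolding alias_sum_def by (rule limI alias_partial_tendsto assms)+

text \<open>The support confines \<open>l\<close> to an interval of length \<open>w\<close>, which
  holds at most \<open>w + 1\<close> integers, and each value is at most 1 whatever its phase. The
  factor \<open>2 / w\<close> of \<open>cap_poisson\<close> then makes the bound uniform in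
  \<open>w\<close>.\<close>

lemma infsum_cap_minus_le:
  fixes n w :: nat and y \<beta> :: real
  assumes "\<beta> \<ge> 0" and w: "w \<ge> 1"
  shows "cmod (\<Sum>\<^sub>\<infinity>l::int. complex_of_real (cap (- \<beta>) ((2 * pi * of_int l - y) / (pi * real w))) * cis (\<theta> l)) \<le> real w + 1"
proof -
  define g where "g l = complex_of_real (cap (- \<beta>) ((2 * pi * of_int l - y) / (pi * real w))) * cis (\<theta> l)" for l :: int
  define I where "I = {\<lceil>y / (2 * pi) - real w / 2\<rceil>..\<lfloor>y / (2 * pi) + real w / 2\<rfloor>}"
  have "(\<Sum>\<^sub>\<infinity>l::int. g l) = (\<Sum>\<^sub>\<infinity>l\<in>I. g l)"
  proof (rule infsum_cong_neutral)
    fix l assume "l \<in> UNIV - I"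
    then have "of_int l < y / (2 * pi) - real w / 2 \<or> of_int l > y / (2 * pi) + real w / 2"
      by (auto simp: I_def ceiling_le_iff le_floor_iff)
    then have "2 * pi * of_int l - y < - (pi * real w) \<or> 2 * pi * of_int l - y > pi * real w"
      by (auto simp: field_simps)
    then have "\<bar>2 * pi * of_int l - y\<bar> > pi * real w" by linarith
    then have "\<bar>(2 * pi * of_int l - y) / (pi * real w)\<bar> > 1" using w by (simp add: abs_divide field_simps)
    then show "g l = 0" by (simp add: g_def cap_eq_0)
  qed auto
  also have "\<dots> = sum g I" by (simp add: I_def)
  also have "cmod \<dots> \<le> (\<Sum>l\<in>I. 1)"
  proof (rule order_trans[OF norm_sum], rule sum_mono)
    fix l assume "l \<in> I"
    have "cap (- \<beta>) z \<le> 1" for z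
      using order_trans[OF cap_le_1 indicator_le_1] assms(1) by simp
    then show "cmod (g l) \<le> 1" by (simp add: g_def norm_mult cap_nonneg)
  qed
  also have "\<dots> = real (nat (\<lfloor>y / (2 * pi) + real w / 2\<rfloor> - \<lceil>y / (2 * pi) - real w / 2\<rceil> + 1))"
    by (simp add: I_def)
  also have "\<dots> \<le> real w + 1"
  proof -
    have "of_int (\<lfloor>y / (2 * pi) + real w / 2\<rfloor> - \<lceil>y / (2 * pi) - real w / 2\<rceil> + 1) \<le> real w + 1"
      using of_int_floor_le[of "y / (2 * pi) + real w / 2"] le_of_int_ceiling[of "y / (2 * pi) - real w / 2"]
      unfolding of_int_add of_int_diff of_int_1 by linarith
    then show ?thesis by (simp add: of_nat_nat_take_bit_eq nat_le_iff of_nat_nat split: split_nat)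
  qed
  finally show ?thesis by (simp add: g_def)
qed

text \<open>Past the cutoff \<open>\<rho> = \<beta>\<close> the part \<open>cap_odd\<close> is absolutely summable over the aliases; for the
  rest, the periodic sum is evaluated by Poisson summation as a finite sum of values of
  \<open>cap (- \<beta>)\<close>, which are at most 1.\<close>

lemma alias_sum_le:
  fixes n w :: nat and k :: int and \<beta> \<gamma> \<tau> x :: real
  assumes n: "n \<ge> 1" and w: "w \<ge> 1" and \<gamma>: "0 < \<gamma>" "\<gamma> < 1" and \<tau>: "\<tau> < 1"
    and k: "\<bar>of_int k\<bar> / real n \<le> \<tau>" and \<beta>: "\<beta> = \<gamma> * pi * real w * (1 - \<tau>)"
  defines "Z \<equiv> (\<Sum>m::nat. real m powr (-3/2))"
    and "q \<equiv> sqrt (1 - \<gamma>\<^sup>2) / \<gamma>"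
  shows "cmod (alias_sum n w \<beta> k x) \<le> pi * real w / real n * exp (- \<beta>) *
           (40 * q powr (-3/2) * \<beta> powr (-1/2) * Z + 6)"
proof -
  have \<beta>0: "\<beta> > 0" using \<gamma> \<tau> w by (simp add: \<beta>)
  have q0: "q > 0" using \<gamma> by (simp add: q_def power_less_one_iff abs_square_less_1)
  define \<rho> where "\<rho> m = pi * real w * (of_int m + of_int k / real n)" for m :: int
  define e where "e m = cis (of_int (k + m * int n) * x)" for m :: int
  define A where "A = pi * real w / real n * exp (- \<beta>)"
  have A0: "A \<ge> 0" by (simp add: A_def)
  have Zs: "summable (\<lambda>m::nat. real m powr (-3/2))" by (subst summable_real_powr_iff) simp
  define P where "P M = (\<Sum>m=-int M..int M. fourier (cap (- \<beta>)) (\<rho> m) * e m)" for M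
  define L where "L = 2 / of_nat w *
          (\<Sum>\<^sub>\<infinity>l::int. complex_of_real (cap (- \<beta>) ((2 * pi * of_int l - real n * x) / (pi * real w))) *
                      cis (of_int k / real n * (2 * pi * of_int l)))"
  have P: "P \<longlonglongrightarrow> L"
    unfolding P_def[abs_def] L_def \<rho>_def e_def by (rule cap_poisson[OF n w])
  have L: "cmod L \<le> 4"
  proof -
    have "cmod L \<le> 2 / real w * (real w + 1)"
      unfolding L_def norm_mult using \<beta>0 w
      by (intro mult_mono infsum_cap_minus_le) (auto simp: norm_divide)
    also have "\<dots> \<le> 4" using w by (simp add: field_simps)
    finally show ?thesis .
  qed
  \<comment> \<open>For \<open>m \<noteq> 0\<close>, \<open>\<bar>k\<bar> / n \<le> \<tau>\<close>
    gives \<open>\<bar>m + k / n\<bar> \<ge> (1 - \<tau>) * \<bar>m\<bar>\<close>, that is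
    \<open>\<beta> * \<bar>m\<bar> \<le> \<gamma> * \<bar>\<rho> m\<bar>\<close>. This yields both
    the distance from the cutoff and linear growth in \<open>m\<close>.\<close>
  have odd: "\<bar>cap_odd \<beta> (\<rho> m)\<bar> \<le> 20 * q powr (-3/2) * \<beta> powr (-1/2) * (real (nat \<bar>m\<bar>)) powr (-3/2)" if "m \<noteq> 0" for m
  proof -
    have m1: "1 \<le> \<bar>real_of_int m\<bar>" using that by linarith
    have "0 \<le> \<tau>" using k by (rule order_trans[rotated]) simp
    then have "\<tau> * 1 \<le> \<tau> * \<bar>real_of_int m\<bar>" using m1 by (intro mult_left_mono)
    then have "(1 - \<tau>) * \<bar>of_int m\<bar> \<le> \<bar>of_int m + of_int k / real n\<bar>"
    proof -
      have "\<bar>of_int k / real n\<bar> \<le> \<tau>" using k by simp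
      then have "\<bar>of_int m\<bar> - \<tau> \<le> \<bar>of_int m + of_int k / real n\<bar>" by linarith
      then show ?thesis using \<open>\<tau> * 1 \<le> \<tau> * \<bar>real_of_int m\<bar>\<close> unfolding left_diff_distrib by linarith
    qed
    then have "pi * real w * ((1 - \<tau>) * \<bar>of_int m\<bar>) \<le> pi * real w * \<bar>of_int m + of_int k / real n\<bar>"
      by (intro mult_left_mono) auto
    also have "\<dots> = \<bar>\<rho> m\<bar>" by (simp add: \<rho>_def abs_mult)
    finally have \<rho>1: "\<beta> * \<bar>of_int m\<bar> \<le> \<gamma> * \<bar>\<rho> m\<bar>"
      using \<gamma>(1) mult_left_mono[of _ _ \<gamma>] by (force simp: \<beta> mult_ac)
    have "\<beta> * 1 \<le> \<beta> * \<bar>of_int m\<bar>" using m1 \<beta>0 by (intro mult_left_mono) auto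
    then have \<rho>2: "\<beta> \<le> \<gamma> * \<bar>\<rho> m\<bar>" using \<rho>1 by linarith
    then have "\<bar>\<rho> m\<bar> > 0" using \<beta>0 by (cases "\<rho> m = 0") auto
    then have "\<gamma> * \<bar>\<rho> m\<bar> < 1 * \<bar>\<rho> m\<bar>" using \<gamma> by (intro mult_strict_right_mono)
    then have gt: "\<beta> < \<bar>\<rho> m\<bar>" using \<rho>2 by linarith
    define t where "t = sqrt ((\<rho> m)\<^sup>2 - \<beta>\<^sup>2)"
    \<comment> \<open>Combine \<open>(\<rho> m)\<^sup>2 - \<beta>\<^sup>2 \<ge> (1 -
      \<gamma>\<^sup>2) * (\<rho> m)\<^sup>2\<close> with \<open>\<bar>\<rho> m\<bar> \<ge> \<beta>
      * \<bar>m\<bar> / \<gamma>\<close>; \<open>q\<close> collects the constants.\<close>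
    have t: "q * \<beta> * \<bar>of_int m\<bar> \<le> t"
      unfolding t_def
    proof (rule real_le_rsqrt)
      have "\<beta>\<^sup>2 \<le> (\<gamma> * \<bar>\<rho> m\<bar>)\<^sup>2" using \<rho>2 \<beta>0 by (intro power_mono) auto
      moreover have "(\<beta> * \<bar>of_int m\<bar>)\<^sup>2 \<le> (\<gamma> * \<bar>\<rho> m\<bar>)\<^sup>2" using \<rho>1 \<beta>0 by (intro power_mono) auto
      then have "(1 - \<gamma>\<^sup>2) / \<gamma>\<^sup>2 * (\<beta> * \<bar>of_int m\<bar>)\<^sup>2 \<le> (1 - \<gamma>\<^sup>2) / \<gamma>\<^sup>2 * (\<gamma> * \<bar>\<rho> m\<bar>)\<^sup>2"
        using \<gamma> by (intro mult_left_mono) (auto simp: power_le_one)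
      moreover have "(1 - \<gamma>\<^sup>2) / \<gamma>\<^sup>2 * (\<gamma> * \<bar>\<rho> m\<bar>)\<^sup>2 = (\<rho> m)\<^sup>2 - (\<gamma> * \<bar>\<rho> m\<bar>)\<^sup>2"
        using \<gamma>(1) by (simp add: power_mult_distrib field_simps)
      moreover have "(q * \<beta> * \<bar>of_int m\<bar>)\<^sup>2 = (1 - \<gamma>\<^sup>2) / \<gamma>\<^sup>2 * (\<beta> * \<bar>of_int m\<bar>)\<^sup>2"
        using \<gamma> by (simp add: q_def power_mult_distrib power_divide power_le_one)
      ultimately show "(q * \<beta> * \<bar>of_int m\<bar>)\<^sup>2 \<le> (\<rho> m)\<^sup>2 - \<beta>\<^sup>2" by linarith
    qed
    have "\<bar>cap_odd \<beta> (\<rho> m)\<bar> \<le> 20 * \<beta> * t powr (-3/2)"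
      unfolding t_def by (rule abs_cap_odd_le[OF \<beta>0 gt])
    also have "\<dots> \<le> 20 * \<beta> * (q * \<beta> * \<bar>of_int m\<bar>) powr (-3/2)"
      using \<beta>0 q0 m1 t by (intro mult_left_mono powr_mono2') auto
    also have "(q * \<beta> * \<bar>of_int m\<bar>) powr (-3/2) = q powr (-3/2) * \<beta> powr (-3/2) * \<bar>of_int m\<bar> powr (-3/2)"
      using \<beta>0 q0 by (simp add: powr_mult)
    also have "20 * \<beta> * (q powr (-3/2) * \<beta> powr (-3/2) * \<bar>of_int m\<bar> powr (-3/2)) =
        20 * q powr (-3/2) * (\<beta> powr 1 * \<beta> powr (-3/2)) * \<bar>of_int m\<bar> powr (-3/2)"
      using \<beta>0 by simp
    also have "\<beta> powr 1 * \<beta> powr (-3/2) = \<beta> powr (-1/2)" by (simp only: powr_add[symmetric]) simp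
    finally show ?thesis by simp
  qed
  \<comment> \<open>The 40 counts both signs of \<open>m\<close>. The term of \<open>Z\<close> at 0
    is \<open>0 powr (-3/2) = 0\<close>.\<close>
  have odd_sum: "cmod (\<Sum>m\<in>{-int M..int M}-{0}. of_real (cap_odd \<beta> (\<rho> m)) * e m) \<le>
      40 * q powr (-3/2) * \<beta> powr (-1/2) * Z" for M
  proof -
    define c where "c = 20 * q powr (-3/2) * \<beta> powr (-1/2)"
    have "cmod (\<Sum>m\<in>{-int M..int M}-{0}. of_real (cap_odd \<beta> (\<rho> m)) * e m) \<le>
      (\<Sum>m\<in>{-int M..int M}-{0}. c * real (nat \<bar>m\<bar>) powr (-3/2))"
      using odd by (intro order_trans[OF norm_sum] sum_mono) (auto simp: norm_mult e_def c_def)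
    also have "\<dots> = (\<Sum>m\<in>int ` {1..M} \<union> (\<lambda>m. - int m) ` {1..M}. c * real (nat \<bar>m\<bar>) powr (-3/2))"
    proof (rule sum.cong)
      show "{-int M..int M} - {0} = int ` {1..M} \<union> (\<lambda>m. - int m) ` {1..M}"
      proof (intro equalityI subsetI)
        fix m assume "m \<in> {-int M..int M} - {0}"
        then have "m = int (nat m) \<and> nat m \<in> {1..M} \<or> m = - int (nat (- m)) \<and> nat (- m) \<in> {1..M}" by auto
        then show "m \<in> int ` {1..M} \<union> (\<lambda>m. - int m) ` {1..M}" by blast
      qed auto
    qed auto
    also have "\<dots> = (\<Sum>m=1..M. c * real m powr (-3/2)) + (\<Sum>m=1..M. c * real m powr (-3/2))"
      by (subst sum.union_disjoint) (auto simp: sum.reindex inj_on_def)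
    also have "\<dots> = 2 * c * (\<Sum>m=1..M. real m powr (-3/2))" by (simp add: sum_distrib_left mult.assoc)
    also have "\<dots> \<le> 2 * c * Z"
      unfolding Z_def by (intro mult_left_mono sum_le_suminf Zs) (auto simp: c_def)
    finally show ?thesis by (simp add: c_def)
  qed
  \<comment> \<open>The aliases of the remainder are the full symmetric sum \<open>P M\<close>
    without its term \<open>m = 0\<close>, which is at most 2 in modulus. With
    \<open>cmod L \<le> 4\<close> in the limit this gives the 6.\<close>
  have bound: "cmod (alias_partial n w \<beta> k x M) \<le> A * (40 * q powr (-3/2) * \<beta> powr (-1/2) * Z + cmod (P M) + 2)" for M
  proof -
    have "alias_partial n w \<beta> k x M =
      of_real A * (\<Sum>m\<in>{-int M..int M}-{0}. of_real (cap_odd \<beta> (\<rho> m)) * e m + fourier (cap (- \<beta>)) (\<rho> m) * e m)"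
      unfolding alias_partial_def psi_hat_alias_eq[OF n w] fourier_cap cap_odd_def sum_distrib_left
      by (intro sum.cong refl) (simp add: A_def \<rho>_def e_def algebra_simps)
    also have "\<dots> = of_real A * ((\<Sum>m\<in>{-int M..int M}-{0}. of_real (cap_odd \<beta> (\<rho> m)) * e m) +
       (P M - fourier (cap (- \<beta>)) (\<rho> 0) * e 0))"
    proof -
      have "(\<Sum>m\<in>{-int M..int M}-{0}. fourier (cap (- \<beta>)) (\<rho> m) * e m) = P M - fourier (cap (- \<beta>)) (\<rho> 0) * e 0"
        unfolding P_def by (subst sum_diff1) auto
      then show ?thesis by (simp only: sum.distrib)
    qed
    also have "cmod \<dots> \<le> A * (40 * q powr (-3/2) * \<beta> powr (-1/2) * Z + (cmod (P M) + 2))"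
    proof -
      have "cmod (fourier (cap (- \<beta>)) (\<rho> 0) * e 0) \<le> 2"
        using abs_cap_cos_le[of "- \<beta>" "\<rho> 0"] \<beta>0 by (simp add: fourier_cap norm_mult e_def)
      then have "cmod (P M - fourier (cap (- \<beta>)) (\<rho> 0) * e 0) \<le> cmod (P M) + 2"
        by (intro order_trans[OF norm_triangle_ineq4]) simp
      then show ?thesis unfolding norm_mult using A0
        by (intro mult_mono order_trans[OF norm_triangle_ineq] add_mono odd_sum) auto
    qed
    finally show ?thesis by (simp add: add.assoc)
  qed
  have lim: "alias_partial n w \<beta> k x \<longlonglongrightarrow> alias_sum n w \<beta> k x"
    unfolding alias_sum_eq[OF n w] by (rule alias_partial_tendsto[OF n w])
  have "(\<lambda>M. A * (40 * q powr (-3/2) * \<beta> powr (-1/2) * Z + cmod (P M) + 2))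
    \<longlonglongrightarrow> A * (40 * q powr (-3/2) * \<beta> powr (-1/2) * Z + cmod L + 2)"
    by (intro tendsto_intros P)
  then have "cmod (alias_sum n w \<beta> k x) \<le> A * (40 * q powr (-3/2) * \<beta> powr (-1/2) * Z + cmod L + 2)"
    by (rule LIMSEQ_le[OF tendsto_norm[OF lim]]) (use bound in auto)
  also have "\<dots> \<le> A * (40 * q powr (-3/2) * \<beta> powr (-1/2) * Z + 6)"
    using L A0 by (intro mult_left_mono) auto
  finally show ?thesis unfolding A_def .
qed

section \<open>Errors of the two algorithms\<close>

lemma psi_eq_0:
  assumes "n \<ge> 1" "w \<ge> 1" "\<bar>y\<bar> > pi * real w / real n"
  shows "psi n w \<beta> y = 0"
proof -
  have "\<bar>real n * y / (pi * real w)\<bar> > 1"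
    using assms by (simp add: abs_mult abs_divide field_simps)
  then show ?thesis using assms(1,2) by (simp add: psi_eq_cap cap_eq_0)
qed

lemma finite_psi_support:
  assumes "n \<ge> 1" "w \<ge> 1" "a \<noteq> 0"
  shows "finite {l::int. psi n w \<beta> (a * of_int l - y) \<noteq> 0}"
proof (rule finite_subset)
  define R where "R = (pi * real w / real n + \<bar>y\<bar>) / \<bar>a\<bar>"
  show "{l::int. psi n w \<beta> (a * of_int l - y) \<noteq> 0} \<subseteq> {- \<lceil>R\<rceil>..\<lceil>R\<rceil>}"
  proof
    fix l assume "l \<in> {l::int. psi n w \<beta> (a * of_int l - y) \<noteq> 0}"
    then have "\<bar>a * of_int l - y\<bar> \<le> pi * real w / real n"
      using psi_eq_0[OF assms(1,2)] by force
    then have "\<bar>a\<bar> * \<bar>of_int l\<bar> \<le> pi * real w / real n + \<bar>y\<bar>" unfolding abs_mult[symmetric] by linarith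
    then have "\<bar>of_int l\<bar> \<le> R" using assms(3) by (simp add: R_def field_simps)
    then show "l \<in> {- \<lceil>R\<rceil>..\<lceil>R\<rceil>}" unfolding atLeastAtMost_iff by linarith
  qed
qed simp

text \<open>Division with remainder: every integer is uniquely \<open>l - n * m\<close> with
  \<open>0 \<le> l < n\<close>. The minus sign matches the translates in the periodization.\<close>

lemma infsum_residue_classes:
  fixes g :: "int \<Rightarrow> complex"
  assumes n: "n \<ge> 1" and fin: "finite {j. g j \<noteq> 0}"
  shows "(\<Sum>l<n. \<Sum>\<^sub>\<infinity>m::int. g (int l - int n * m)) = (\<Sum>\<^sub>\<infinity>j. g j)"
proof -
  define h where "h = (\<lambda>(l, m). int l - int n * m)"
  have bij: "bij_betw h ({..<n} \<times> UNIV) UNIV"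
  proof (rule bij_betw_byWitness[where f'="\<lambda>j. (nat (j mod int n), - (j div int n))"])
    show "\<forall>a\<in>{..<n} \<times> UNIV. (nat (h a mod int n), - (h a div int n)) = a"
    proof
      fix a :: "nat \<times> int" assume "a \<in> {..<n} \<times> UNIV"
      then obtain l m where a: "a = (l, m)" "l < n" by auto
      have "(int l - int n * m) mod int n = int l"
        using a(2) by (simp add: mod_diff_right_eq[symmetric] mod_diff_left_eq mod_pos_pos_trivial)
      moreover have "(int l - int n * m) div int n = - m"
        using a(2) div_mult_self2[of "int n" "int l" "- m"] by simp
      ultimately show "(nat (h a mod int n), - (h a div int n)) = a" by (simp add: a h_def)
    qed
    show "\<forall>j\<in>UNIV. h (nat (j mod int n), - (j div int n)) = j"
      using n by (auto simp: h_def)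
    show "(\<lambda>j. (nat (j mod int n), - (j div int n))) ` UNIV \<subseteq> {..<n} \<times> UNIV"
      using n by (auto simp: nat_less_iff)
  qed simp
  have "g summable_on {j. g j \<noteq> 0}" using fin by (rule summable_on_finite)
  then have sum: "g summable_on UNIV"
    by (subst summable_on_cong_neutral[where T="{j. g j \<noteq> 0}" and g=g]) auto
  have "(\<Sum>\<^sub>\<infinity>j. g j) = (\<Sum>\<^sub>\<infinity>p\<in>{..<n} \<times> UNIV. g (h p))"
    by (rule infsum_reindex_bij_betw[OF bij, symmetric])
  also have "\<dots> = (\<Sum>\<^sub>\<infinity>l\<in>{..<n}. \<Sum>\<^sub>\<infinity>m. g (h (l, m)))"
  proof (rule infsum_Sigma_banach[symmetric])
    show "(\<lambda>p. g (h p)) summable_on Sigma {..<n} (\<lambda>_. UNIV)"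
      using summable_on_reindex_bij_betw[OF bij, of g] sum by simp
  qed
  finally show ?thesis by (simp add: h_def)
qed

text \<open>\<open>cis (2 * pi * l * k / n)\<close> is unchanged when \<open>l\<close> moves by a
  multiple of \<open>n\<close>, so the sums over grid and periods merge into one sum over all
  integers. Poisson summation evaluates it as the wanted term plus all aliases.\<close>

lemma periodized_dft:
  assumes n: "n \<ge> 1" and w: "w \<ge> 1"
  shows "(\<Sum>l<n. cis (2 * pi * real l * of_int k / real n) *
            complex_of_real (psi_periodized n w \<beta> (2 * pi * real l / real n - y))) =
      of_nat n / (2 * pi) * (alias_sum n w \<beta> k y + psi_hat n w \<beta> k * cis (of_int k * y))"
proof -
  define g where "g j = complex_of_real (psi n w \<beta> (2 * pi * of_int j / real n - y)) *
     cis (2 * pi * of_int j * of_int k / real n)" for j :: int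
  have gfin: "finite {j. g j \<noteq> 0}"
    using finite_psi_support[OF n w, of "2 * pi / real n" \<beta> y] n by (simp add: g_def)
  have "cis (2 * pi * real l * of_int k / real n) *
            complex_of_real (psi_periodized n w \<beta> (2 * pi * real l / real n - y)) =
        (\<Sum>\<^sub>\<infinity>m::int. g (int l - int n * m))" for l
  proof -
    have eq: "g (int l - int n * m) = cis (2 * pi * real l * of_int k / real n) *
       complex_of_real (psi n w \<beta> (2 * pi * real l / real n - y - 2 * pi * of_int m))" for m
    proof -
      have "2 * pi * of_int (int l - int n * m) / real n - y = 2 * pi * real l / real n - y - 2 * pi * of_int m"
        using n by (simp add: field_simps)
      moreover have "cis (2 * pi * of_int (int l - int n * m) * of_int k / real n) =
          cis (2 * pi * real l * of_int k / real n) * cis (2 * pi * of_int (- m * k))"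
        unfolding cis_mult using n by (intro arg_cong[where f=cis]) (simp add: field_simps)
      moreover have "cis (2 * pi * of_int (- m * k)) = 1" by (intro cis_multiple_2pi) simp
      ultimately show ?thesis unfolding g_def by (simp only:) (simp add: mult.commute)
    qed
    have "complex_of_real (psi_periodized n w \<beta> z) = (\<Sum>\<^sub>\<infinity>m::int. complex_of_real (psi n w \<beta> (z - 2 * pi * of_int m)))" for z
    proof -
      have "finite {m::int. psi n w \<beta> (z - 2 * pi * of_int m) \<noteq> 0}"
        using finite_psi_support[OF n w, of "- 2 * pi" \<beta> "- z"] by (simp add: algebra_simps)
      then have "(\<lambda>m::int. psi n w \<beta> (z - 2 * pi * of_int m)) summable_on UNIV"
        by (subst summable_on_cong_neutral[where T="{m::int. psi n w \<beta> (z - 2 * pi * of_int m) \<noteq> 0}"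
            and g="\<lambda>m::int. psi n w \<beta> (z - 2 * pi * of_int m)"]) auto
      then have "((\<lambda>m::int. psi n w \<beta> (z - 2 * pi * of_int m)) has_sum psi_periodized n w \<beta> z) UNIV"
        unfolding psi_periodized_def by (rule has_sum_infsum)
      then show ?thesis by (intro infsumI[symmetric]) (simp only: has_sum_of_real_iff)
    qed
    then show ?thesis unfolding eq by (simp add: infsum_cmult_right')
  qed
  then have "(\<Sum>l<n. cis (2 * pi * real l * of_int k / real n) *
            complex_of_real (psi_periodized n w \<beta> (2 * pi * real l / real n - y))) = (\<Sum>\<^sub>\<infinity>j. g j)"
    by (simp add: infsum_residue_classes[OF n gfin])
  then show ?thesis unfolding alias_sum_eq[OF n w] g_def using n by simp
qed

text \<open>The correction factor inverts the term \<open>m = 0\<close> of the Poisson sum exactly,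
  so only the aliases survive, divided by \<open>psi_hat\<close>.\<close>

lemma type1_error:
  assumes n: "n \<ge> 1" and w: "w \<ge> 1" and nz: "psi_hat n w \<beta> k \<noteq> 0"
  shows "type1_nufft n w \<beta> M x c k - type1_exact M x c k =
     (\<Sum>j=1..M. c j * (alias_sum n w \<beta> k (x j) / psi_hat n w \<beta> k))"
proof -
  have "(\<Sum>l<n. cis (2 * pi * real l * of_int k / real n) * spread n w \<beta> M x c l) =
     (\<Sum>j=1..M. c j * (\<Sum>l<n. cis (2 * pi * real l * of_int k / real n) *
            complex_of_real (psi_periodized n w \<beta> (2 * pi * real l / real n - x j))))"
    unfolding spread_def sum_distrib_left by (subst sum.swap) (simp add: mult_ac)
  also have "\<dots> = (\<Sum>j=1..M. c j * (of_nat n / (2 * pi) *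
      (alias_sum n w \<beta> k (x j) + psi_hat n w \<beta> k * cis (of_int k * x j))))"
    unfolding periodized_dft[OF n w] ..
  finally have S: "(\<Sum>l<n. cis (2 * pi * real l * of_int k / real n) * spread n w \<beta> M x c l) = \<dots>" .
  have "type1_nufft n w \<beta> M x c k = (\<Sum>j=1..M. c j * (alias_sum n w \<beta> k (x j) / psi_hat n w \<beta> k) +
       c j * cis (of_int k * x j))"
    unfolding type1_nufft_def S sum_distrib_left correction_def
    by (intro sum.cong refl) (use nz n in \<open>simp add: field_simps\<close>)
  then show ?thesis by (simp add: type1_exact_def sum.distrib)
qed

text \<open>By adjointness the conjugates of the type 1 ratios appear. The algorithm uses the
  correction unconjugated, which is consistent because \<open>psi_hat\<close> is real.\<close>

lemma type2_error:
  assumes n: "n \<ge> 1" and w: "w \<ge> 1" and nz: "\<And>k. k \<in> modes N \<Longrightarrow> psi_hat n w \<beta> k \<noteq> 0"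
  shows "type2_nufft N n w \<beta> x f j - type2_exact N x f j =
     (\<Sum>k\<in>modes N. f k * cnj (alias_sum n w \<beta> k (x j) / psi_hat n w \<beta> k))"
proof -
  have "type2_nufft N n w \<beta> x f j =
    (\<Sum>k\<in>modes N. correction n w \<beta> k * f k * cnj (\<Sum>l<n. cis (2 * pi * real l * of_int k / real n) *
            complex_of_real (psi_periodized n w \<beta> (2 * pi * real l / real n - x j))))"
    unfolding type2_nufft_def sum_distrib_left cnj_sum
    by (subst sum.swap) (simp add: mult_ac cis_cnj)
  also have "\<dots> = (\<Sum>k\<in>modes N. f k * cnj (alias_sum n w \<beta> k (x j) / psi_hat n w \<beta> k) +
       f k * cis (- (of_int k * x j)))"
    unfolding periodized_dft[OF n w]
  proof (rule sum.cong[OF refl])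
    fix k assume "k \<in> modes N"
    then have nz': "psi_hat n w \<beta> k \<noteq> 0" by (rule nz)
    have real: "cnj (psi_hat n w \<beta> k) = psi_hat n w \<beta> k"
      unfolding psi_hat_eq[OF n w] by simp
    show "correction n w \<beta> k * f k * cnj (of_nat n / (2 * pi) *
        (alias_sum n w \<beta> k (x j) + psi_hat n w \<beta> k * cis (of_int k * x j))) =
       f k * cnj (alias_sum n w \<beta> k (x j) / psi_hat n w \<beta> k) + f k * cis (- (of_int k * x j))"
      unfolding correction_def using nz' n by (simp add: real cis_cnj field_simps)
  qed
  finally show ?thesis by (simp add: type2_exact_def sum.distrib)
qed

section \<open>From alias ratios to the rate\<close>

lemma finite_sym_modes: "finite (sym_modes N)"
proof (rule finite_subset)
  show "sym_modes N \<subseteq> {- int N..int N}"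
    by (auto simp: sym_modes_def)
qed simp

lemma zero_in_modes: "N \<ge> 1 \<Longrightarrow> 0 \<in> modes N"
  by (simp add: modes_def)

lemma modes_subset_sym_modes: "modes N \<subseteq> sym_modes N"
  by (auto simp: modes_def sym_modes_def abs_le_iff)

lemma alias_div_le_eps_inf:
  assumes k: "k \<in> sym_modes N"
    and bdd: "bdd_above ((\<lambda>(k, x). cmod (alias_sum n w \<beta> k x)) ` (sym_modes N \<times> UNIV))"
    and nz: "\<And>k. k \<in> sym_modes N \<Longrightarrow> psi_hat n w \<beta> k \<noteq> 0"
  shows "cmod (alias_sum n w \<beta> k y / psi_hat n w \<beta> k) \<le> eps_inf N n w \<beta>"
proof -
  have fin: "finite ((\<lambda>k. cmod (psi_hat n w \<beta> k)) ` sym_modes N)"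
    using finite_sym_modes by simp
  have "cmod (alias_sum n w \<beta> k y) \<le> (SUP (k, x)\<in>sym_modes N \<times> UNIV. cmod (alias_sum n w \<beta> k x))"
    using cSUP_upper[OF _ bdd, of "(k, y)"] k by simp
  moreover have "(MIN k\<in>sym_modes N. cmod (psi_hat n w \<beta> k)) \<le> cmod (psi_hat n w \<beta> k)"
    using fin k by (intro Min_le) auto
  moreover have "0 < (MIN k\<in>sym_modes N. cmod (psi_hat n w \<beta> k))"
    using fin k nz by (subst Min_gr_iff) auto
  ultimately show ?thesis
    unfolding eps_inf_def norm_divide by (intro frac_le) (auto intro: order_trans[OF norm_ge_zero])
qed

text \<open>With \<open>W = pi * w\<close> the left side is
  \<open>\<beta>\<^sup>2 - \<rho>\<^sup>2\<close> at the band edge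
  \<open>\<bar>k\<bar> = N / 2\<close>; its root is the exponent of the rate.\<close>

lemma square_gap_eq:
  fixes \<gamma> \<sigma> W :: real
  assumes "\<gamma> \<noteq> 0" "\<sigma> \<noteq> 0"
  shows "(\<gamma> * W * (1 - 1 / (2 * \<sigma>)))\<^sup>2 - (W * (1 / (2 * \<sigma>)))\<^sup>2 =
    (W * \<gamma>)\<^sup>2 * (1 - 1 / \<sigma> - (\<gamma> powi (- 2) - 1) / (4 * \<sigma>\<^sup>2))"
proof -
  have "\<gamma> powi (- 2) = 1 / \<gamma>\<^sup>2" by (simp add: power_int_minus divide_inverse)
  then show ?thesis using assms by (simp add: field_simps power2_eq_square)
qed

text \<open>For \<open>\<beta> \<ge> 2\<close> the estimates
  \<open>1 + s \<le> 3 / 2 * \<beta>\<close> and \<open>1 + s \<le> 4 * \<beta>\<close> turn 64 into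
  192 and leave \<open>\<beta> / (\<beta> * sqrt \<beta>)\<close>. The odd part is at least 4, twice
  the bound on the remainder, so subtracting the remainder costs at most half: 384.\<close>

lemma cap_cos_ge:
  assumes \<beta>: "2 \<le> \<beta>" and \<rho>: "\<bar>\<rho>\<bar> \<le> \<beta>" and s0: "s0 \<le> sqrt (\<beta>\<^sup>2 - \<rho>\<^sup>2)"
  shows "exp s0 / (384 * sqrt \<beta>) \<le> cap_cos \<beta> \<rho>"
proof -
  have \<beta>0: "0 < \<beta>" using \<beta> by simp
  define s where "s = sqrt (\<beta>\<^sup>2 - \<rho>\<^sup>2)"
  have "\<rho>\<^sup>2 \<le> \<beta>\<^sup>2" using \<rho> \<beta>0 abs_le_square_iff[of \<rho> \<beta>] by simp
  then have s: "0 \<le> s" by (simp add: s_def)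
  have "s \<le> sqrt (\<beta>\<^sup>2)" unfolding s_def by (intro real_sqrt_le_mono) simp
  then have s\<beta>: "s \<le> \<beta>" using \<beta>0 by simp
  have "(1 + s) * sqrt (1 + s) \<le> (3 / 2 * \<beta>) * (2 * sqrt \<beta>)"
  proof (intro mult_mono)
    have "sqrt (1 + s) \<le> sqrt (4 * \<beta>)" using s\<beta> \<beta> by (intro real_sqrt_le_mono) linarith
    then show "sqrt (1 + s) \<le> 2 * sqrt \<beta>" by (simp add: real_sqrt_mult)
  qed (use s s\<beta> \<beta> in auto)
  then have le: "64 * ((1 + s) * sqrt (1 + s)) \<le> 192 * \<beta> * sqrt \<beta>" by simp
  have "exp s0 / (192 * sqrt \<beta>) \<le> exp s / (192 * sqrt \<beta>)"
    using s0 \<beta>0 by (intro divide_right_mono) (auto simp: s_def)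
  also have "\<dots> = \<beta> * (exp s / (192 * \<beta> * sqrt \<beta>))" using \<beta>0 by simp
  also have "\<dots> \<le> \<beta> * (exp s / (64 * ((1 + s) * sqrt (1 + s))))"
    using \<beta>0 s le by (intro mult_left_mono divide_left_mono mult_pos_pos) auto
  also have "\<dots> \<le> cap_odd \<beta> \<rho>" unfolding s_def by (rule cap_odd_ge_exp[OF \<beta>0 \<rho>])
  finally have 1: "exp s0 / (192 * sqrt \<beta>) \<le> cap_odd \<beta> \<rho>" .
  have "2 * 3 \<le> \<beta> * pi" using \<beta> pi_gt3 by (intro mult_mono) auto
  then have "4 \<le> cap_odd \<beta> \<rho>" using cap_odd_ge_pi[OF \<beta>0 \<rho>] by linarith
  moreover have "\<bar>cap_cos (- \<beta>) \<rho>\<bar> \<le> 2" using \<beta>0 by (intro abs_cap_cos_le) simp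
  moreover have "cap_cos \<beta> \<rho> = cap_odd \<beta> \<rho> + cap_cos (- \<beta>) \<rho>" by (simp add: cap_odd_def)
  ultimately have "cap_odd \<beta> \<rho> / 2 \<le> cap_cos \<beta> \<rho>" by linarith
  moreover have "exp s0 / (384 * sqrt \<beta>) = exp s0 / (192 * sqrt \<beta>) / 2" by simp
  ultimately show ?thesis using 1 by linarith
qed

theorem theorem1:
  fixes N n :: nat and \<gamma> \<sigma> :: real and \<beta> :: "nat \<Rightarrow> real"
  assumes "N \<ge> 1" and "n > N" and "\<sigma> = real n / real N"
    and "0 < \<gamma>" and "\<gamma> < 1"
    and "\<And>w. \<beta> w = \<gamma> * pi * real w * (1 - 1 / (2 * \<sigma>))"
  shows
    \<comment> \<open>the numerator of \<open>eps_inf\<close> is meaningful\<close>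
    "(\<forall>w\<ge>1. (\<forall>k\<in>sym_modes N. \<forall>x. convergent (alias_partial n w (\<beta> w) k x)) \<and>
             bdd_above ((\<lambda>(k, x). cmod (alias_sum n w (\<beta> w) k x)) ` (sym_modes N \<times> UNIV)))
     \<and>
     \<comment> \<open>error bounds, whenever the divisions in the algorithm and in \<open>eps_inf\<close> are defined\<close>
     (\<forall>w\<ge>1. (\<forall>k\<in>sym_modes N. psi_hat n w (\<beta> w) k \<noteq> 0) \<longrightarrow>
        (\<forall>M\<ge>1. \<forall>x :: nat \<Rightarrow> real. (\<forall>j\<in>{1..M}. - pi \<le> x j \<and> x j < pi) \<longrightarrow>
           (\<forall>c :: nat \<Rightarrow> complex.
              (MAX k\<in>modes N. cmod (type1_nufft n w (\<beta> w) M x c k - type1_exact M x c k))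
                \<le> eps_inf N n w (\<beta> w) * (\<Sum>j=1..M. cmod (c j))) \<and>
           (\<forall>f :: int \<Rightarrow> complex.
              (MAX j\<in>{1..M}. cmod (type2_nufft N n w (\<beta> w) x f j - type2_exact N x f j))
                \<le> eps_inf N n w (\<beta> w) * (\<Sum>k\<in>modes N. cmod (f k)))))
     \<and>
     \<comment> \<open>if the square root in the rate is real, the divisions are always defined, and
         the rate holds\<close>
     (0 \<le> 1 - 1 / \<sigma> - (\<gamma> powi (- 2) - 1) / (4 * \<sigma>\<^sup>2) \<longrightarrow>
        (\<forall>w\<ge>1. \<forall>k\<in>sym_modes N. psi_hat n w (\<beta> w) k \<noteq> 0) \<and>
        (\<lambda>w. eps_inf N n w (\<beta> w)) \<in>
          O(\<lambda>w. sqrt (real w) *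
                 exp (- pi * real w * \<gamma> *
                      sqrt (1 - 1 / \<sigma> - (\<gamma> powi (- 2) - 1) / (4 * \<sigma>\<^sup>2)))))"
proof -
  note \<gamma> = assms(4,5) and \<beta> = assms(6)
  have n1: "n \<ge> 1" using assms by simp
  \<comment> \<open>In the variable of \<open>cap_cos\<close>, \<open>pi * w * \<tau>\<close> is the
    band edge and \<open>pi * w * (1 - \<tau>) = \<beta> / \<gamma>\<close> the position of the
    nearest alias of that edge.\<close>
  define \<tau> where "\<tau> = 1 / (2 * \<sigma>)"
  have \<sigma>: "\<sigma> > 1" using assms by simp
  have \<tau>: "0 < \<tau>" "\<tau> < 1 / 2" using \<sigma> by (auto simp: \<tau>_def)
  have sym: "\<bar>of_int k\<bar> / real n \<le> \<tau>" if "k \<in> sym_modes N" for k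
    using that n1 by (simp add: sym_modes_def \<tau>_def assms(3) field_simps)
  have \<beta>\<tau>: "\<beta> w = \<gamma> * pi * real w * (1 - \<tau>)" for w by (simp add: \<beta> \<tau>_def)
  define b where "b = \<gamma> * pi * (1 - \<tau>)"
  have b: "b > 0" "\<beta> w = b * real w" for w using \<gamma> \<tau> by (auto simp: b_def \<beta>\<tau>)
  define Z where "Z = (\<Sum>m::nat. real m powr (-3/2))"
  define q where "q = sqrt (1 - \<gamma>\<^sup>2) / \<gamma>"
  define U where "U w = pi * real w / real n * exp (- \<beta> w) *
     (40 * q powr (-3/2) * \<beta> w powr (-1/2) * Z + 6)" for w
  have U: "cmod (alias_sum n w (\<beta> w) k x) \<le> U w" if "w \<ge> 1" "k \<in> sym_modes N" for w k x
    unfolding U_def Z_def q_def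
    by (rule alias_sum_le[OF n1 that(1) \<gamma> _ sym[OF that(2)] \<beta>\<tau>]) (use \<tau> in simp)
  have bdd: "bdd_above ((\<lambda>(k, x). cmod (alias_sum n w (\<beta> w) k x)) ` (sym_modes N \<times> UNIV))" if "w \<ge> 1" for w
    using U[OF that] by (intro bdd_aboveI[where M="U w"]) auto
  have conv: "convergent (alias_partial n w (\<beta> w) k x)" if "w \<ge> 1" for w k x
    using alias_partial_tendsto[OF n1 that] by (rule convergentI)
  have eps: "cmod (alias_sum n w (\<beta> w) k y / psi_hat n w (\<beta> w) k) \<le> eps_inf N n w (\<beta> w)"
    if "w \<ge> 1" "\<forall>k\<in>sym_modes N. psi_hat n w (\<beta> w) k \<noteq> 0" "k \<in> sym_modes N" for w k y
    by (rule alias_div_le_eps_inf[OF that(3) bdd[OF that(1)]]) (use that in auto)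
  have type1: "(MAX k\<in>modes N. cmod (type1_nufft n w (\<beta> w) M x c k - type1_exact M x c k))
      \<le> eps_inf N n w (\<beta> w) * (\<Sum>j=1..M. cmod (c j))"
    if w: "w \<ge> 1" and nz: "\<forall>k\<in>sym_modes N. psi_hat n w (\<beta> w) k \<noteq> 0" for w M x c
  proof (rule Max.boundedI)
    fix a assume "a \<in> (\<lambda>k. cmod (type1_nufft n w (\<beta> w) M x c k - type1_exact M x c k)) ` modes N"
    then obtain k where k: "k \<in> sym_modes N" and a: "a = cmod (type1_nufft n w (\<beta> w) M x c k - type1_exact M x c k)"
      using modes_subset_sym_modes by auto
    have "a \<le> (\<Sum>j=1..M. cmod (c j * (alias_sum n w (\<beta> w) k (x j) / psi_hat n w (\<beta> w) k)))"
      unfolding a using nz k by (subst type1_error[OF n1 w]) (auto intro: norm_sum)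
    also have "\<dots> \<le> (\<Sum>j=1..M. cmod (c j) * eps_inf N n w (\<beta> w))"
      unfolding norm_mult by (intro sum_mono mult_left_mono eps w nz k) auto
    finally show "a \<le> eps_inf N n w (\<beta> w) * (\<Sum>j=1..M. cmod (c j))"
      by (simp add: sum_distrib_left mult.commute)
  qed (use finite_subset[OF modes_subset_sym_modes finite_sym_modes] zero_in_modes[OF assms(1)] in auto)
  have type2: "(MAX j\<in>{1..M}. cmod (type2_nufft N n w (\<beta> w) x f j - type2_exact N x f j))
      \<le> eps_inf N n w (\<beta> w) * (\<Sum>k\<in>modes N. cmod (f k))"
    if w: "w \<ge> 1" and nz: "\<forall>k\<in>sym_modes N. psi_hat n w (\<beta> w) k \<noteq> 0" and "M \<ge> 1" for w M x f
  proof (rule Max.boundedI)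
    fix a assume "a \<in> (\<lambda>j. cmod (type2_nufft N n w (\<beta> w) x f j - type2_exact N x f j)) ` {1..M}"
    then obtain j where a: "a = cmod (type2_nufft N n w (\<beta> w) x f j - type2_exact N x f j)" by auto
    have "a \<le> (\<Sum>k\<in>modes N. cmod (f k * cnj (alias_sum n w (\<beta> w) k (x j) / psi_hat n w (\<beta> w) k)))"
      unfolding a using nz modes_subset_sym_modes
      by (subst type2_error[OF n1 w]) (auto intro: norm_sum)
    also have "\<dots> \<le> (\<Sum>k\<in>modes N. cmod (f k) * eps_inf N n w (\<beta> w))"
      unfolding norm_mult complex_mod_cnj
      by (intro sum_mono mult_left_mono eps w nz) (use modes_subset_sym_modes in auto)
    finally show "a \<le> eps_inf N n w (\<beta> w) * (\<Sum>k\<in>modes N. cmod (f k))"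
      by (simp add: sum_distrib_left mult.commute)
  qed (use \<open>M \<ge> 1\<close> in auto)
  define S where "S = 1 - 1 / \<sigma> - (\<gamma> powi (- 2) - 1) / (4 * \<sigma>\<^sup>2)"
  define \<rho> where "\<rho> w k = pi * real w * (of_int k / real n)" for w :: nat and k :: int
  have psi_hat: "cmod (psi_hat n w (\<beta> w) k) = pi * real w / real n * exp (- \<beta> w) * \<bar>cap_cos (\<beta> w) (\<rho> w k)\<bar>"
    if "w \<ge> 1" for w k
    unfolding psi_hat_eq[OF n1 that] \<rho>_def by (simp add: norm_mult norm_divide)
  have rate: "(\<forall>w\<ge>1. \<forall>k\<in>sym_modes N. psi_hat n w (\<beta> w) k \<noteq> 0) \<and>
      (\<lambda>w. eps_inf N n w (\<beta> w)) \<in> O(\<lambda>w. sqrt (real w) * exp (- pi * real w * \<gamma> * sqrt S))"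
    if S: "0 \<le> S"
  proof -
    have gap: "(\<beta> w)\<^sup>2 - (pi * real w * \<tau>)\<^sup>2 = (pi * real w * \<gamma>)\<^sup>2 * S" for w
      using square_gap_eq[of \<gamma> \<sigma> "pi * real w"] \<gamma> \<sigma> by (simp add: \<beta> \<tau>_def S_def mult_ac)
    have \<rho>\<tau>: "\<bar>\<rho> w k\<bar> \<le> pi * real w * \<tau>" if "k \<in> sym_modes N" for w k
      using mult_left_mono[OF sym[OF that], of "pi * real w"] by (simp add: \<rho>_def abs_mult abs_divide)
    \<comment> \<open>By \<open>gap\<close>, \<open>0 \<le> S\<close> means that the band edge does
      not pass the cutoff.\<close>
    have \<tau>\<beta>: "pi * real w * \<tau> \<le> \<beta> w" for w
    proof (rule power2_le_imp_le)
      show "(pi * real w * \<tau>)\<^sup>2 \<le> (\<beta> w)\<^sup>2" using gap[of w] S by (smt (verit) zero_le_power2 mult_nonneg_nonneg)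
      show "0 \<le> \<beta> w" using b by simp
    qed
    have pos: "0 < cap_cos (\<beta> w) (\<rho> w k)" if "w \<ge> 1" "k \<in> sym_modes N" for w k
    proof (rule cap_cos_pos)
      show "0 < \<beta> w" using b that(1) by simp
      show "\<bar>\<rho> w k\<bar> \<le> \<beta> w" using \<rho>\<tau>[OF that(2), of w] \<tau>\<beta>[of w] by linarith
    qed
    have nz: "psi_hat n w (\<beta> w) k \<noteq> 0" if "w \<ge> 1" "k \<in> sym_modes N" for w k
      using pos[OF that] n1 that(1) psi_hat[OF that(1), of k] by auto
    define C where "C = 384 * sqrt b * (40 * q powr (-3/2) * Z + 6)"
    have bound: "eps_inf N n w (\<beta> w) \<le> C * (sqrt (real w) * exp (- pi * real w * \<gamma> * sqrt S)) \<and> 0 \<le> eps_inf N n w (\<beta> w)"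
      if "w \<ge> 1" "2 \<le> \<beta> w" for w
    proof
      define A where "A = pi * real w / real n * exp (- \<beta> w)"
      define s0 where "s0 = pi * real w * \<gamma> * sqrt S"
      have A: "A > 0" using that n1 by (simp add: A_def)
      have Z0: "Z \<ge> 0" unfolding Z_def by (intro suminf_nonneg) (auto simp: summable_real_powr_iff)
      have ne: "sym_modes N \<noteq> {}" using zero_in_modes[OF assms(1)] modes_subset_sym_modes by blast
      define K where "K = 40 * q powr (-3/2) * Z + 6"
      have K: "K > 0" using Z0 by (simp add: K_def add_nonneg_pos)
      \<comment> \<open>This makes the constant \<open>K\<close> in the numerator independent of
        \<open>w\<close>.\<close>
      have "\<beta> w powr (-1/2) \<le> 1" using that(2) by (simp add: powr_minus_divide powr_half_sqrt)
      show "0 \<le> eps_inf N n w (\<beta> w)"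
        using eps[of w 0 0] nz that zero_in_modes[OF assms(1)] modes_subset_sym_modes
        by (meson norm_ge_zero order_trans subsetD)
      have num: "(SUP (k, x)\<in>sym_modes N \<times> UNIV. cmod (alias_sum n w (\<beta> w) k x)) \<le> A * K"
      proof (rule cSUP_least)
        fix p :: "int \<times> real" assume "p \<in> sym_modes N \<times> UNIV"
        then obtain k x where p: "p = (k, x)" and k: "k \<in> sym_modes N" by auto
        have "q powr (-3/2) * (\<beta> w powr (-1/2) * Z) \<le> q powr (-3/2) * (1 * Z)"
          using \<open>\<beta> w powr (-1/2) \<le> 1\<close> Z0 by (intro mult_left_mono mult_right_mono) auto
        then have "U w \<le> A * K"
          unfolding U_def A_def[symmetric] K_def using A by (intro mult_left_mono) auto
        then show "(case p of (k, x) \<Rightarrow> cmod (alias_sum n w (\<beta> w) k x)) \<le> A * K"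
          using U[OF that(1) k, of x] by (simp add: p)
      qed (use ne in auto)
      have den: "A * (exp s0 / (384 * sqrt (\<beta> w))) \<le> (MIN k\<in>sym_modes N. cmod (psi_hat n w (\<beta> w) k))"
      proof (rule Min.boundedI)
        fix a assume "a \<in> (\<lambda>k. cmod (psi_hat n w (\<beta> w) k)) ` sym_modes N"
        then obtain k where k: "k \<in> sym_modes N" and a: "a = cmod (psi_hat n w (\<beta> w) k)" by auto
        \<comment> \<open>The band edge is the worst case: it has the smallest gap to the
          cutoff.\<close>
        have "(\<rho> w k)\<^sup>2 \<le> (pi * real w * \<tau>)\<^sup>2"
          using power_mono[OF \<rho>\<tau>[OF k, of w], of 2] by simp
        then have "(pi * real w * \<gamma>)\<^sup>2 * S \<le> (\<beta> w)\<^sup>2 - (\<rho> w k)\<^sup>2" using gap[of w] by linarith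
        then have "sqrt ((pi * real w * \<gamma>)\<^sup>2 * S) \<le> sqrt ((\<beta> w)\<^sup>2 - (\<rho> w k)\<^sup>2)" by (rule real_sqrt_le_mono)
        then have s0: "s0 \<le> sqrt ((\<beta> w)\<^sup>2 - (\<rho> w k)\<^sup>2)"
          using \<gamma> by (simp add: s0_def real_sqrt_mult)
        have "exp s0 / (384 * sqrt (\<beta> w)) \<le> cap_cos (\<beta> w) (\<rho> w k)"
          using \<rho>\<tau>[OF k, of w] \<tau>\<beta>[of w] by (intro cap_cos_ge that s0) auto
        then have "A * (exp s0 / (384 * sqrt (\<beta> w))) \<le> A * \<bar>cap_cos (\<beta> w) (\<rho> w k)\<bar>"
          using A by (intro mult_left_mono) auto
        then show "A * (exp s0 / (384 * sqrt (\<beta> w))) \<le> a"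
          unfolding a psi_hat[OF that(1)] A_def by simp
      qed (use ne finite_sym_modes in auto)
      \<comment> \<open>The common factor \<open>A\<close>, with its
        \<open>exp (- \<beta> w)\<close>, cancels; the exponential decay comes from the denominator
        alone.\<close>
      have "eps_inf N n w (\<beta> w) \<le> (A * K) / (A * (exp s0 / (384 * sqrt (\<beta> w))))"
        unfolding eps_inf_def using A K that by (intro frac_le num den) auto
      also have "\<dots> = 384 * K * sqrt (\<beta> w) * exp (- s0)"
        using A that(2) by (simp add: exp_minus field_simps)
      also have "sqrt (\<beta> w) = sqrt b * sqrt (real w)" by (simp add: b(2) real_sqrt_mult)
      finally show "eps_inf N n w (\<beta> w) \<le> C * (sqrt (real w) * exp (- pi * real w * \<gamma> * sqrt S))"
        by (simp add: C_def K_def s0_def mult_ac)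
    qed
    have large: "eventually (\<lambda>w. 2 \<le> \<beta> w) sequentially"
    proof -
      obtain w0 :: nat where "2 / b \<le> real w0" using real_arch_simple by blast
      then have "2 \<le> \<beta> w" if "w \<ge> w0" for w
      proof -
        have "2 / b \<le> real w" using \<open>2 / b \<le> real w0\<close> that by simp
        then show ?thesis using b by (simp add: field_simps)
      qed
      then show ?thesis by (auto simp: eventually_sequentially)
    qed
    have "\<forall>\<^sub>F w in sequentially. norm (eps_inf N n w (\<beta> w)) \<le>
        C * norm (sqrt (real w) * exp (- pi * real w * \<gamma> * sqrt S))"
      using large eventually_ge_at_top[of "1::nat"]
    proof eventually_elim
      case (elim w)
      then show ?case using bound[of w] by simp
    qed
    then have "(\<lambda>w. eps_inf N n w (\<beta> w)) \<in> O(\<lambda>w. sqrt (real w) * exp (- pi * real w * \<gamma> * sqrt S))"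
      by (rule bigoI)
    then show ?thesis using nz by blast
  qed
  show ?thesis
  proof (intro conjI[OF _ conjI])
    show "\<forall>w\<ge>1. (\<forall>k\<in>sym_modes N. \<forall>x. convergent (alias_partial n w (\<beta> w) k x)) \<and>
             bdd_above ((\<lambda>(k, x). cmod (alias_sum n w (\<beta> w) k x)) ` (sym_modes N \<times> UNIV))"
      by (intro allI impI conjI ballI conv bdd)
  next
    show "0 \<le> 1 - 1 / \<sigma> - (\<gamma> powi (- 2) - 1) / (4 * \<sigma>\<^sup>2) \<longrightarrow>
        (\<forall>w\<ge>1. \<forall>k\<in>sym_modes N. psi_hat n w (\<beta> w) k \<noteq> 0) \<and>
        (\<lambda>w. eps_inf N n w (\<beta> w)) \<in>
          O(\<lambda>w. sqrt (real w) *
                 exp (- pi * real w * \<gamma> *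
                      sqrt (1 - 1 / \<sigma> - (\<gamma> powi (- 2) - 1) / (4 * \<sigma>\<^sup>2))))"
      using rate unfolding S_def by (rule impI)
  qed (intro allI impI conjI type1 type2; assumption)
qed

end
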